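(* If there exists an output-polynomial time algorithm for \textsc{MCS Enumeration}, then \textsc{Another MCS} can be solved in polynomial time.
   Context: A string $Y$ is a subsequence of $X$ if $Y$ is obtained from $X$ by deleting zero or more characters. For a finite set $\mathcal S$ of strings, a maximal common subsequence (MCS) is a string that is a subsequence of every string of $\mathcal S$ and is not a proper subsequence of any other such string. \textsc{MCS Enumeration}: given $\mathcal S$, output all MCSs of $\mathcal S$. \textsc{Another MCS}: given $\mathcal S$ and a set $\mathcal Z$ of MCSs of $\mathcal S$, decide whether some MCS of $\mathcal S$ is not in $\mathcal Z$ (the input size is $\|\mathcal S\|+\|\mathcal Z\|$, total lengths of the strings). An enumeration algorithm is output-polynomial if its running time is bounded by a polynomial in $\|\mathcal S\|$ plus the total size of the set of all MCSs of $\mathcal S$. *)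

theory Defs
  imports "HOL-Library.Sublist" "HOL-Computational_Algebra.Polynomial"
begin

section \<open>Maximal common subsequences\<close>

text \<open>Characters are natural numbers; \<^const>\<open>subseq\<close> allows deletion at arbitrary positions.\<close>

type_synonym str = "nat list"

definition common_subseq :: "str set \<Rightarrow> str \<Rightarrow> bool" where
  "common_subseq S Y \<longleftrightarrow> (\<forall>X\<in>S. subseq Y X)"

definition MCS :: "str set \<Rightarrow> str set" where
  "MCS S = {Y. common_subseq S Y \<and> \<not> (\<exists>Y'. common_subseq S Y' \<and> strict_subseq Y Y')}"

definition total_length :: "str set \<Rightarrow> nat" where
  "total_length S = (\<Sum>X\<in>S. length X)"

text \<open>
  The size of an input is its total length, so characters have to be polynomially bounded in the
  size for the input to be readable in polynomial time. The function \<open>\<sigma>\<close> gives the size of the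
  alphabet in terms of the total length: a constant \<open>\<sigma>\<close> is a fixed finite alphabet, while
  \<open>\<sigma> n = n\<close> leaves the alphabet unbounded, since a set of total length \<open>n\<close> has at most \<open>n\<close>
  distinct characters.
\<close>

definition over_alphabet :: "(nat \<Rightarrow> nat) \<Rightarrow> str set \<Rightarrow> bool" where
  "over_alphabet \<sigma> S \<longleftrightarrow> (\<forall>X\<in>S. \<forall>c\<in>set X. c < \<sigma> (total_length S))"

definition poly_bounded :: "(nat \<Rightarrow> nat) \<Rightarrow> bool" where
  "poly_bounded f \<longleftrightarrow> (\<exists>p :: nat poly. \<forall>n. f n \<le> poly p n)"


section \<open>Deterministic multi-tape Turing machines\<close>

datatype insym = Bit bool | EndChar | EndStr | EndSet

text \<open>\<open>Work n\<close> are the symbols a machine may use besides the blank and the input symbols.\<close>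

datatype sym = Blank | In insym | Work nat

datatype move = L | N | R

text \<open>A two-way infinite tape together with the position of its head.\<close>

type_synonym tape = "(int \<Rightarrow> sym) \<times> int"

record 'q tm =
  num_tapes :: nat
  states :: "'q set"
  tape_alphabet :: "sym set"
  start :: 'q
  accept :: 'q
  reject :: 'q
  delta :: "'q \<Rightarrow> sym list \<Rightarrow> 'q \<times> (sym \<times> move) list"

text \<open>Tape 0 is the input tape and tape 1 the output tape.\<close>

definition wf_tm :: "'q tm \<Rightarrow> bool" where
  "wf_tm M \<longleftrightarrow>
     num_tapes M \<ge> 2 \<and>
     finite (states M) \<and> finite (tape_alphabet M) \<and>
     Blank \<in> tape_alphabet M \<and> range In \<subseteq> tape_alphabet M \<and>
     start M \<in> states M \<and> accept M \<in> states M \<and> reject M \<in> states M \<and>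
     accept M \<noteq> reject M \<and>
     (\<forall>q \<in> states M - {accept M, reject M}. \<forall>ss.
        length ss = num_tapes M \<and> set ss \<subseteq> tape_alphabet M \<longrightarrow>
        (case delta M q ss of (q', as) \<Rightarrow>
           q' \<in> states M \<and> length as = num_tapes M \<and> fst ` set as \<subseteq> tape_alphabet M))"

type_synonym 'q config = "'q \<times> tape list"

definition read :: "tape \<Rightarrow> sym" where
  "read t = (case t of (T, h) \<Rightarrow> T h)"

fun shift :: "move \<Rightarrow> int \<Rightarrow> int" where
  "shift L h = h - 1"
| "shift N h = h"
| "shift R h = h + 1"

definition act :: "sym \<times> move \<Rightarrow> tape \<Rightarrow> tape" where
  "act a t = (case a of (s, d) \<Rightarrow> case t of (T, h) \<Rightarrow> (T(h := s), shift d h))"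

definition halted :: "'q tm \<Rightarrow> 'q config \<Rightarrow> bool" where
  "halted M c \<longleftrightarrow> fst c = accept M \<or> fst c = reject M"

definition step :: "'q tm \<Rightarrow> 'q config \<Rightarrow> 'q config" where
  "step M c =
     (if halted M c then c
      else case c of (q, ts) \<Rightarrow>
        case delta M q (map read ts) of (q', as) \<Rightarrow> (q', map2 act as ts))"

definition word_tape :: "insym list \<Rightarrow> int \<Rightarrow> sym" where
  "word_tape w i = (if 0 \<le> i \<and> i < int (length w) then In (w ! nat i) else Blank)"

definition init :: "'q tm \<Rightarrow> insym list \<Rightarrow> 'q config" where
  "init M w = (start M, (word_tape w, 0) # replicate (num_tapes M - 1) (\<lambda>_. Blank, 0))"

definition run :: "'q tm \<Rightarrow> insym list \<Rightarrow> nat \<Rightarrow> 'q config" where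
  "run M w t = (step M ^^ t) (init M w)"

definition outputs_within :: "'q tm \<Rightarrow> insym list \<Rightarrow> insym list \<Rightarrow> nat \<Rightarrow> bool" where
  "outputs_within M w v n \<longleftrightarrow>
     (\<exists>t\<le>n. halted M (run M w t) \<and> fst (snd (run M w t) ! 1) = word_tape v)"

definition accepts_within :: "'q tm \<Rightarrow> insym list \<Rightarrow> nat \<Rightarrow> bool" where
  "accepts_within M w n \<longleftrightarrow> (\<exists>t\<le>n. fst (run M w t) = accept M)"

definition rejects_within :: "'q tm \<Rightarrow> insym list \<Rightarrow> nat \<Rightarrow> bool" where
  "rejects_within M w n \<longleftrightarrow> (\<exists>t\<le>n. fst (run M w t) = reject M)"


section \<open>Encoding of inputs and outputs\<close>

text \<open>Binary representation, least significant bit first, without leading zeros.\<close>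

fun bits :: "nat \<Rightarrow> bool list" where
  "bits n = (if n = 0 then [] else odd n # bits (n div 2))"

declare bits.simps [simp del]

definition enc_char :: "nat \<Rightarrow> insym list" where
  "enc_char c = map Bit (bits c) @ [EndChar]"

definition enc_str :: "str \<Rightarrow> insym list" where
  "enc_str X = concat (map enc_char X) @ [EndStr]"

definition enc_strs :: "str list \<Rightarrow> insym list" where
  "enc_strs Xs = concat (map enc_str Xs) @ [EndSet]"


section \<open>The two problems\<close>

text \<open>
  An input set is presented as a list of its elements without repetitions, in any order.
  The MCSs may be output in any order; repetitions in the output are allowed.
\<close>

definition output_poly_MCS_enumeration :: "(nat \<Rightarrow> nat) \<Rightarrow> 'q tm \<Rightarrow> bool" where
  "output_poly_MCS_enumeration \<sigma> M \<longleftrightarrow>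
     wf_tm M \<and>
     (\<exists>p :: nat poly. \<forall>Xs. distinct Xs \<and> over_alphabet \<sigma> (set Xs) \<longrightarrow>
        (\<exists>Ys. set Ys = MCS (set Xs) \<and>
              outputs_within M (enc_strs Xs) (enc_strs Ys)
                (poly p (total_length (set Xs) + total_length (MCS (set Xs))))))"

definition poly_time_Another_MCS :: "(nat \<Rightarrow> nat) \<Rightarrow> 'q tm \<Rightarrow> bool" where
  "poly_time_Another_MCS \<sigma> M \<longleftrightarrow>
     wf_tm M \<and>
     (\<exists>p :: nat poly. \<forall>Xs Zs.
        distinct Xs \<and> over_alphabet \<sigma> (set Xs) \<and> distinct Zs \<and> set Zs \<subseteq> MCS (set Xs) \<longrightarrow>
        (if \<exists>Y \<in> MCS (set Xs). Y \<notin> set Zs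
         then accepts_within M (enc_strs Xs @ enc_strs Zs)
                (poly p (total_length (set Xs) + total_length (set Zs)))
         else rejects_within M (enc_strs Xs @ enc_strs Zs)
                (poly p (total_length (set Xs) + total_length (set Zs)))))"

end

theory Submission
  imports Defs "HOL-Library.Countable"
begin

text \<open>
  Let \<open>p\<close> be a polynomial time bound of the enumeration machine \<open>M\<close>, and run \<open>M\<close> on \<open>S\<close> for at least
  \<open>p (\<parallel>S\<parallel> + \<parallel>Z\<parallel>)\<close> steps. If \<open>Z\<close> contains all maximal common subsequences, \<open>M\<close> halts within this
  time; so if it does not halt, another one exists. If it halts, each string of its output is looked
  up in \<open>Z\<close>; the output is no longer than the running time. The clock is a counter
  with a constant number of digits in base \<open>l + 1\<close>, where \<open>l\<close> is the length of the input.
\<close>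

section \<open>Polynomial bounds\<close>

text \<open>On admissible inputs \<open>M\<close> always halts with a correct output, so a run that
  happens to halt after the enumeration bound but before the timeout is as good as any other. Only
  the timeout needs an argument. The clock is not set to \<open>p n\<close>, which would have to be
  computed. Instead \<open>p n \<le> (n + 2) ^ j\<close>, and the encoded input has length at least
  \<open>n + 2\<close>, so the fixed number \<open>k = Suc j\<close> of digits suffices whatever the
  input is. The obstacle in reading the output is that the tape is infinite in both directions: when
  \<open>M\<close> halts, its output head may stand far away among blanks, with no sign of the
  direction in which the output lies. This is why a head on a copy of the input has to accompany it.
  Time is measured in total length while the machine depends on encoded length;
  \<open>poly_bounded \<sigma>\<close> bounds the second by a polynomial in the first.\<close>

lemma poly_nat_mono: "a \<le> b \<Longrightarrow> poly p a \<le> poly p b" for a b :: nat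
  by (induction p) (auto intro!: add_mono mult_mono)

lemma poly_boundedI: "(\<And>n. f n \<le> poly p n) \<Longrightarrow> poly_bounded f"
  by (auto simp: poly_bounded_def)

lemma poly_bounded_poly: "poly_bounded (poly p)"
  by (rule poly_boundedI[of _ p]) simp

lemma poly_bounded_const: "poly_bounded (\<lambda>_. c)"
  by (rule poly_boundedI[of _ "[:c:]"]) simp

lemma poly_bounded_ident: "poly_bounded (\<lambda>n. n)"
  by (rule poly_boundedI[of _ "[:0, 1:]"]) simp

lemma poly_bounded_add:
  assumes "poly_bounded f" "poly_bounded g"
  shows "poly_bounded (\<lambda>n. f n + g n)"
proof -
  obtain p q where "\<And>n. f n \<le> poly p n" "\<And>n. g n \<le> poly q n"
    using assms by (auto simp: poly_bounded_def)
  then show ?thesis by (intro poly_boundedI[of _ "p + q"]) (simp add: add_mono)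
qed

lemma poly_bounded_mult:
  assumes "poly_bounded f" "poly_bounded g"
  shows "poly_bounded (\<lambda>n. f n * g n)"
proof -
  obtain p q where "\<And>n. f n \<le> poly p n" "\<And>n. g n \<le> poly q n"
    using assms by (auto simp: poly_bounded_def)
  then show ?thesis by (intro poly_boundedI[of _ "p * q"]) (simp add: mult_mono)
qed

lemma poly_bounded_power: "poly_bounded f \<Longrightarrow> poly_bounded (\<lambda>n. f n ^ k)"
  by (induction k) (auto intro: poly_bounded_const poly_bounded_mult)

lemmas poly_bounded_intros =
  poly_bounded_const poly_bounded_ident poly_bounded_add poly_bounded_mult poly_bounded_power

text \<open>The base is at least 2, so a coefficient \<open>a\<close> is absorbed by the exponent
  through \<open>a \<le> 2 ^ a\<close>. A pure power is what a clock with \<open>k\<close> digits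
  can measure.\<close>

lemma poly_le_power: "\<exists>k. \<forall>n. poly p n \<le> (n + 2) ^ k" for p :: "nat poly"
proof (induction p)
  case 0
  show ?case by auto
next
  case (pCons a p)
  then obtain k where k: "poly p n \<le> (n + 2) ^ k" for n by auto
  have "poly (pCons a p) n \<le> (n + 2) ^ (a + k + 1)" for n
  proof -
    have "a \<le> 2 ^ a" by (simp add: less_imp_le)
    also have "\<dots> \<le> (n + 2) ^ a" by (rule power_mono) auto
    also have "\<dots> \<le> (n + 2) ^ (a + k)" by (rule power_increasing) auto
    finally have "a \<le> (n + 2) ^ (a + k)" .
    moreover have "n * poly p n \<le> n * (n + 2) ^ (a + k)"
      by (intro mult_left_mono le_trans[OF k] power_increasing) auto
    ultimately have "poly (pCons a p) n \<le> (n + 2) ^ (a + k) + n * (n + 2) ^ (a + k)"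
      unfolding poly_pCons by (rule add_mono)
    also have "\<dots> \<le> (n + 2) ^ (a + k + 1)" by simp
    finally show ?thesis .
  qed
  then show ?case by blast
qed


section \<open>The encoding\<close>

abbreviation enc_chars :: "str \<Rightarrow> insym list" where
  "enc_chars X \<equiv> concat (map enc_char X)"

abbreviation lines :: "insym list list \<Rightarrow> insym list" where
  "lines bs \<equiv> concat (map (\<lambda>b. b @ [EndStr]) bs)"

text \<open>The machine only compares words separated by \<open>EndStr\<close>. In this form its
  analysis can ignore how characters are encoded; \<open>enc_chars_inner\<close> is all that it
  needs.\<close>

lemma enc_strs_lines: "enc_strs Xs = lines (map enc_chars Xs) @ [EndSet]"
  by (simp add: enc_strs_def enc_str_def[abs_def] comp_def)

lemma enc_chars_inner: "EndStr \<notin> set (enc_chars X)" "EndSet \<notin> set (enc_chars X)"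
  by (auto simp: enc_char_def)

lemma inj_bits: "inj bits"
proof
  fix m n show "bits m = bits n \<Longrightarrow> m = n"
  proof (induction m arbitrary: n rule: bits.induct)
    case (1 m)
    have zero: "bits k = [] \<longleftrightarrow> k = 0" for k by (simp add: bits.simps[of k])
    show ?case
    proof (cases "m = 0 \<or> n = 0")
      case True
      with "1.prems" zero show ?thesis by metis
    next
      case False
      with "1.prems" have "odd m = odd n" "bits (m div 2) = bits (n div 2)"
        by (simp_all add: bits.simps[of m] bits.simps[of n])
      with "1.IH" False have "odd m = odd n" "m div 2 = n div 2" by auto
      then show ?thesis by (metis div_mult_mod_eq odd_iff_mod_2_eq_one not_mod_2_eq_1_eq_0)
    qed
  qed
qed

text \<open>The terminator \<open>EndChar\<close> makes the code prefix-free, so the first character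
  can be split off whatever follows.\<close>

lemma inj_enc_char_append:
  assumes "enc_char c @ u = enc_char d @ v"
  shows "c = d \<and> u = v"
proof -
  have *: "bs = bs' \<and> u = v"
    if "map Bit bs @ EndChar # u = map Bit bs' @ EndChar # v" for bs bs'
    using that
  proof (induction bs arbitrary: bs')
    case Nil
    then show ?case by (cases bs') auto
  next
    case (Cons b bs)
    then show ?case by (cases bs') auto
  qed
  show ?thesis using *[of "bits c" "bits d"] assms inj_bits by (auto simp: enc_char_def dest: injD)
qed

text \<open>Makes comparing encoded lines equivalent to comparing strings.\<close>

lemma inj_enc_chars: "inj enc_chars"
proof
  fix X Y show "enc_chars X = enc_chars Y \<Longrightarrow> X = Y"
  proof (induction X arbitrary: Y)
    case Nil
    then show ?case by (cases Y) (auto simp: enc_char_def)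
  next
    case (Cons c X)
    show ?case
    proof (cases Y)
      case Nil
      with Cons.prems show ?thesis by (simp add: enc_char_def)
    next
      case (Cons d Y')
      with Cons.prems have "c = d \<and> enc_chars X = enc_chars Y'"
        by (intro inj_enc_char_append) simp
      with Cons Cons.IH[of Y'] show ?thesis by simp
    qed
  qed
qed

section \<open>Encoded length against total length\<close>

lemma length_bits_le: "length (bits n) \<le> n"
proof (induction n rule: bits.induct)
  case (1 n)
  show ?case
  proof (cases "n = 0")
    case False
    with 1 have "length (bits n) \<le> Suc (n div 2)" by (simp add: bits.simps[of n])
    with False show ?thesis by linarith
  qed (simp add: bits.simps)
qed

lemma length_enc_chars_ge: "length X \<le> length (enc_chars X)"
  by (induction X) (auto simp: enc_char_def)

lemma length_enc_chars_le: "(\<And>c. c \<in> set X \<Longrightarrow> c < s) \<Longrightarrow> length (enc_chars X) \<le> length X * s"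
proof (induction X)
  case (Cons c X)
  \<comment> \<open>The strict bound \<open>c < s\<close> pays for the extra
    \<open>EndChar\<close>.\<close>
  have "length (enc_char c) \<le> s" using Cons.prems[of c] length_bits_le[of c] by
      (simp add: enc_char_def)
  with Cons show ?case by fastforce
qed simp

lemma total_length_set: "distinct Xs \<Longrightarrow> total_length (set Xs) = sum_list (map length Xs)"
  by (simp add: total_length_def sum_list_distinct_conv_sum_set)

lemma length_enc_strs_ge: "distinct Xs \<Longrightarrow> total_length (set Xs) < length (enc_strs Xs)"
proof -
  have "sum_list (map length Xs) \<le> length (lines (map enc_chars Xs))"
  proof (induction Xs)
    case (Cons X Xs)
    then show ?case using length_enc_chars_ge[of X] by simp
  qed simp
  then show "distinct Xs \<Longrightarrow> ?thesis" by (simp add: enc_strs_lines total_length_set)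
qed

text \<open>At most one of the strings is empty.\<close>

lemma length_distinct_le:
  assumes "distinct Xs"
  shows "length Xs \<le> Suc (total_length (set Xs))"
proof -
  have "card (set Xs - {[]}) \<le> (\<Sum>X \<in> set Xs - {[]}. length X)"
    using sum_mono[of "set Xs - {[]}" "\<lambda>_. 1" length] by (simp add: Suc_le_eq)
  also have "\<dots> \<le> total_length (set Xs)"
    unfolding total_length_def by (rule sum_mono2) auto
  finally show ?thesis
    using card_Diff1_le[of "set Xs" "[]"] assms by
        (auto simp: distinct_card card_Diff_singleton_if split: if_splits)
qed

text \<open>The factor \<open>Suc s\<close> and the constant 2 come from \<open>s\<close> symbols
  per character, at most \<open>total_length + 1\<close> end marks of strings, and the final
  \<open>EndSet\<close>.\<close>

lemma length_enc_strs_le: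
  assumes "distinct Xs" "\<And>X c. X \<in> set Xs \<Longrightarrow> c \<in> set X \<Longrightarrow> c < s"
  shows "length (enc_strs Xs) \<le> total_length (set Xs) * Suc s + 2"
proof -
  have "length (lines (map enc_chars Xs)) \<le> sum_list (map length Xs) * s + length Xs"
    using assms(2)
  proof (induction Xs)
    case (Cons X Xs)
    then have "length (enc_chars X) \<le> length X * s" by (intro length_enc_chars_le) auto
    moreover have "length (lines (map enc_chars Xs)) \<le> sum_list (map length Xs) * s + length Xs"
      using Cons.prems by (intro Cons.IH) auto
    ultimately show ?case by (simp add: algebra_simps)
  qed simp
  with length_distinct_le[OF assms(1)] show ?thesis
    by (simp add: enc_strs_lines total_length_set[OF assms(1)] algebra_simps)
qed

text \<open>For the empty set every word is a common subsequence, hence none is maximal. This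
  provides the string that \<open>MCS_chars\<close> needs.\<close>

lemma MCS_empty: "MCS {} = {}"
proof -
  have "\<exists>Y'. strict_subseq Y Y'" for Y :: str
    by (intro exI[of _ "0 # Y"]) (auto simp: subseq_order.less_le_not_le dest: list_emb_length)
  then show ?thesis by (auto simp: MCS_def common_subseq_def)
qed

text \<open>Carries the alphabet bound from the input strings over to the given MCSs, for which none
  is assumed.\<close>

lemma MCS_chars:
  assumes "Y \<in> MCS S" "c \<in> set Y"
  shows "\<exists>X\<in>S. c \<in> set X"
proof -
  have "S \<noteq> {}" using assms(1) by (auto simp: MCS_empty)
  then obtain X where "X \<in> S" by blast
  moreover from this have "subseq Y X" using assms(1) by (auto simp: MCS_def common_subseq_def)
  ultimately show ?thesis using assms(2) by (auto elim: list_emb_set)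
qed


section \<open>Iterating a function a bounded number of times\<close>

text \<open>An upper bound on the number of steps instead of the exact number, so that bounds add up
  and can be relaxed freely.\<close>

definition reach :: "('a \<Rightarrow> 'a) \<Rightarrow> nat \<Rightarrow> 'a \<Rightarrow> 'a \<Rightarrow> bool" where
  "reach f n a b \<longleftrightarrow> (\<exists>m\<le>n. (f ^^ m) a = b)"

lemma reach_refl: "reach f n a a"
  by (auto simp: reach_def intro: exI[of _ 0])

lemma reach_step: "reach f n (f a) b \<Longrightarrow> reach f (Suc n) a b"
  unfolding reach_def
proof (elim exE conjE)
  fix m assume "m \<le> n" "(f ^^ m) (f a) = b"
  then show "\<exists>m\<le>Suc n. (f ^^ m) a = b"
    by (intro exI[of _ "Suc m"]) (simp add: funpow_swap1)
qed

lemma reach_trans: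
  assumes "reach f m a b" "reach f n b c"
  shows "reach f (m + n) a c"
proof -
  obtain i j where "i \<le> m" "(f ^^ i) a = b" "j \<le> n" "(f ^^ j) b = c"
    using assms by (auto simp: reach_def)
  then have "(f ^^ (j + i)) a = c" "j + i \<le> m + n" by (auto simp: funpow_add)
  then show ?thesis unfolding reach_def by blast
qed

lemma reach_mono: "reach f m a b \<Longrightarrow> m \<le> n \<Longrightarrow> reach f n a b"
  by (auto simp: reach_def intro: le_trans)


section \<open>Looking for a new line\<close>

datatype scan = Seek move | Back | Skip | Match | NextC | RestartY | Rewind | Acc | Rej

text \<open>
  Two heads, one on a tape \<open>lines ys @ [EndSet]\<close> and one on a tape
  \<open>x @ [EndSet] @ lines zs @ [EndSet]\<close>, decide whether some line in \<open>ys\<close> is not in \<open>zs\<close>.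
  \<open>Seek\<close>, \<open>Back\<close> and \<open>Skip\<close> only bring the heads, which start at a common but
  unknown position, to the beginning of \<open>lines ys\<close> and \<open>lines zs\<close>.
\<close>

fun scan_move :: "scan \<Rightarrow> sym \<Rightarrow> sym \<Rightarrow> scan \<times> move \<times> move" where
  "scan_move (Seek d) y c = (if c = Blank then (Seek d, d, d) else (Back, N, N))"
| "scan_move Back y c = (if c = Blank then (Skip, R, R) else (Back, L, L))"
| "scan_move Skip y c = (if c = In EndSet then (Match, N, R) else (Skip, N, R))"
| "scan_move Match y c =
    (if y = In EndSet then (Rej, N, N) else if c = In EndSet then (Acc, N, N)
     else if y \<noteq> c then (NextC, N, N) else if y = In EndStr then (Rewind, R, N)
     else (Match, R, R))"
| "scan_move NextC y c = (if c = In EndStr then (RestartY, L, R) else (NextC, N, R))"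
| "scan_move RestartY y c =
    (if y = Blank \<or> y = In EndStr then (Match, R, N) else (RestartY, L, N))"
| "scan_move Rewind y c = (if c = In EndSet then (Match, N, R) else (Rewind, N, L))"
| "scan_move Acc y c = (Acc, N, N)"
| "scan_move Rej y c = (Rej, N, N)"

text \<open>The search never writes, so two fixed words and two head positions describe it
  completely. \<open>step_scan\<close> transfers it to the machine.\<close>

definition scan_step :: "insym list \<Rightarrow> insym list \<Rightarrow> scan \<times> int \<times> int \<Rightarrow> scan \<times> int \<times> int" where
  "scan_step v w = (\<lambda>(q, i, j). case scan_move q (word_tape v i) (word_tape w j) of
     (q', m, n) \<Rightarrow> (q', shift m i, shift n j))"

lemma scan_step:
  "scan_step v w (q, i, j) = (case scan_move q (word_tape v i) (word_tape w j) of
     (q', m, n) \<Rightarrow> (q', shift m i, shift n j))"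
  by (simp add: scan_step_def)

text \<open>Prepends one move. The new positions are separate equations, which leaves the integer
  arithmetic to the simplifier.\<close>

lemma reach_scan:
  assumes "reach (scan_step v w) k (q', i', j') c"
    and "scan_move q (word_tape v i) (word_tape w j) = (q', m, n)"
    and "i' = shift m i" "j' = shift n j"
  shows "reach (scan_step v w) (Suc k) (q, i, j) c"
  using assms by (intro reach_step) (simp add: scan_step)

lemmas reach_scan_last = reach_scan[OF reach_refl]

lemma word_tape_append: "word_tape (p @ s # r) (int (length p)) = In s"
  by (simp add: word_tape_def)

lemma word_tape_Blank: "word_tape w i = Blank \<longleftrightarrow> i < 0 \<or> int (length w) \<le> i"
  by (auto simp: word_tape_def)

section \<open>Bringing the heads to the beginning of the words\<close>

lemma reach_Seek_right:
  assumes "w \<noteq> []" "i < 0"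
  shows "reach (scan_step v w) (Suc (nat (- i))) (Seek R, i, i) (Back, 0, 0)"
  using assms(2)
proof (induction "nat (- i)" arbitrary: i)
  case (Suc n)
  show ?case
  proof (cases "i = -1")
    case True
    have "reach (scan_step v w) (Suc 0) (Seek R, 0, 0) (Back, 0, 0)"
      using assms(1) by (intro reach_scan_last[where m = N and n = N]) (auto simp: word_tape_Blank)
    then have "reach (scan_step v w) (Suc (Suc 0)) (Seek R, i, i) (Back, 0, 0)"
      by (rule reach_scan[where m = R and n = R]) (use True in \<open>auto simp: word_tape_Blank\<close>)
    with True show ?thesis by simp
  next
    case False
    with Suc(2) Suc.prems have "reach (scan_step v w) (Suc (nat (- (i + 1)))) (Seek R, i + 1, i + 1)
        (Back, 0, 0)"
      by (intro Suc(1)) auto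
    moreover have "Suc (nat (- (i + 1))) = nat (- i)" using Suc.prems by simp
    ultimately have "reach (scan_step v w) (nat (- i)) (Seek R, i + 1, i + 1) (Back, 0, 0)" by simp
    then show ?thesis
      by (rule reach_scan[where m = R and n = R]) (use Suc.prems in \<open>auto simp: word_tape_Blank\<close>)
  qed
qed auto

lemma reach_Seek_left:
  assumes "w \<noteq> []" "int (length w) \<le> i"
  shows "reach (scan_step v w) (nat i + 2) (Seek L, i, i)
      (Back, int (length w) - 1, int (length w) - 1)"
proof -
  have "reach (scan_step v w) (n + 2) (Seek L, int (length w + n), int (length w + n))
          (Back, int (length w) - 1, int (length w) - 1)" for n
  proof (induction n)
    case 0
    have "reach (scan_step v w) (Suc 0) (Seek L, int (length w) - 1, int (length w) - 1)
        (Back, int (length w) - 1, int (length w) - 1)"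
      using assms(1) by (intro reach_scan_last[where m = N and n = N])
        (auto simp: word_tape_Blank simp flip: length_greater_0_conv)
    then have "reach (scan_step v w) (Suc (Suc 0)) (Seek L, int (length w), int (length w))
        (Back, int (length w) - 1, int (length w) - 1)"
      by (rule reach_scan[where m = L and n = L]) (auto simp: word_tape_Blank)
    then show ?case by (simp add: numeral_2_eq_2)
  next
    case (Suc n)
    then show ?case
      unfolding add_Suc
      by (rule reach_scan[where m = L and n = L]) (auto simp: word_tape_Blank)
  qed
  from this[of "nat i - length w"] show ?thesis
    using assms(2) by (auto intro: reach_mono)
qed

lemma reach_Back:
  assumes "-1 \<le> i" "i < int (length w)"
  shows "reach (scan_step v w) (nat i + 2) (Back, i, i) (Skip, 0, 0)"
  using assms
proof (induction "nat (i + 1)" arbitrary: i)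
  case 0
  then have "i = -1" by simp
  then show ?case unfolding add_2_eq_Suc'
    by (intro reach_scan_last[where m = R and n = R]) (auto simp: word_tape_Blank)
next
  case (Suc n)
  then have "0 \<le> i" by simp
  have "reach (scan_step v w) (nat (i - 1) + 2) (Back, i - 1, i - 1) (Skip, 0, 0)"
    using Suc by (intro Suc(1)) auto
  then have "reach (scan_step v w) (Suc (nat (i - 1) + 2)) (Back, i, i) (Skip, 0, 0)" if "0 \<noteq> i"
    by (rule reach_scan[where m = L and n = L])
        (use Suc.prems \<open>0 \<le> i\<close> in \<open>auto simp: word_tape_Blank\<close>)
  \<comment> \<open>Since \<open>nat (- 1) = nat 0\<close>, the induction hypothesis would cost one
    step too many here; the two steps are counted directly.\<close>
  moreover have "reach (scan_step v w) 2 (Back, 0, 0) (Skip, 0, 0)" if "0 = i"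
  proof -
    have "reach (scan_step v w) (Suc 0) (Back, -1, -1) (Skip, 0, 0)"
      by (rule reach_scan_last[where m = R and n = R]) (auto simp: word_tape_Blank)
    then show ?thesis unfolding numeral_2_eq_2
      by (rule reach_scan[where m = L and n = L])
        (use Suc.prems that in \<open>auto simp: word_tape_Blank\<close>)
  qed
  ultimately show ?case using \<open>0 \<le> i\<close> by (cases "i = 0") (auto intro: reach_mono)
qed

text \<open>Off the word \<open>w\<close> only one direction leads back, and \<open>d\<close> is
  assumed to be that one. Within the word \<open>Seek\<close> ends at once, so \<open>d\<close> may
  be anything there, in particular \<open>N\<close>.\<close>

lemma reach_Seek:
  assumes "w \<noteq> []" "i < 0 \<Longrightarrow> d = R" "int (length w) \<le> i \<Longrightarrow> d = L"
  shows "reach (scan_step v w) (nat \<bar>i\<bar> + length w + 4) (Seek d, i, i) (Skip, 0, 0)"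
proof -
  consider "i < 0" | "0 \<le> i" "i < int (length w)" | "int (length w) \<le> i" by linarith
  then show ?thesis
  proof cases
    case 1
    have "reach (scan_step v w) (Suc (nat (- i)) + (nat 0 + 2)) (Seek R, i, i) (Skip, 0, 0)"
      using 1 assms by (intro reach_trans[OF reach_Seek_right reach_Back]) auto
    with 1 assms show ?thesis by (auto intro: reach_mono)
  next
    case 2
    have "reach (scan_step v w) (Suc (nat i + 2)) (Seek d, i, i) (Skip, 0, 0)"
      by (rule reach_scan[where m = N and n = N, OF reach_Back])
        (use 2 in \<open>auto simp: word_tape_Blank\<close>)
    with 2 show ?thesis by (auto intro: reach_mono)
  next
    case 3
    have "reach (scan_step v w) (nat i + 2 + (nat (int (length w) - 1) + 2)) (Seek L, i, i)
        (Skip, 0, 0)"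
      using 3 assms by (intro reach_trans[OF reach_Seek_left reach_Back])
        (auto simp: Suc_le_eq simp flip: length_greater_0_conv)
    with 3 assms show ?thesis by (auto intro: reach_mono)
  qed
qed

lemma reach_Skip:
  assumes "w = p @ u @ EndSet # r" "EndSet \<notin> set u"
  shows "reach (scan_step v w) (Suc (length u)) (Skip, i, int (length p))
           (Match, i, int (length p + length u + 1))"
  using assms
proof (induction u arbitrary: p)
  case Nil
  then show ?case
    by (intro reach_scan_last[where m = N and n = R]) (auto simp: word_tape_append)
next
  case (Cons a u)
  have "reach (scan_step v w) (length (a # u)) (Skip, i, int (length p) + 1)
          (Match, i, int (length p + length (a # u) + 1))"
    using Cons.prems Cons.IH[of "p @ [a]"] by (simp add: add_ac)
  then show ?case
    by (rule reach_scan[where m = N and n = R])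
      (use Cons.prems in \<open>auto simp: word_tape_append\<close>)
qed

section \<open>Comparing one line with the lines of the other word\<close>

lemma reach_Rewind:
  assumes "w = p @ EndSet # u @ c # r" "EndSet \<notin> set u" "c \<noteq> EndSet"
  shows "reach (scan_step v w) (length u + 2) (Rewind, i, int (length p + length u + 1))
           (Match, i, int (length p + 1))"
  using assms
\<comment> \<open>The head starts on \<open>c\<close>, just behind \<open>u\<close>; after one move
  to the left the last symbol of \<open>u\<close> takes over the role of \<open>c\<close>.\<close>
proof (induction u arbitrary: c r rule: rev_induct)
  case Nil
  have "word_tape w (int (length (p @ [EndSet]))) = In c"
    using Nil word_tape_append[of "p @ [EndSet]" c r] by simp
  moreover have "word_tape w (int (length p)) = In EndSet" using Nil by (simp add: word_tape_append)
  ultimately show ?case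
    using Nil by (auto simp: add_ac scan_step numeral_2_eq_2 intro!: reach_step reach_refl)
next
  case (snoc a u)
  have "reach (scan_step v w) (length u + 2) (Rewind, i, int (length p + length u + 1))
      (Match, i, int (length p + 1))"
    using snoc.prems by (intro snoc.IH[of a "c # r"]) auto
  moreover have "word_tape w (int (length (p @ EndSet # u @ [a]))) = In c"
    unfolding snoc.prems(1) using word_tape_append[of "p @ EndSet # u @ [a]" c r] by simp
  ultimately show ?case unfolding length_append_singleton add_Suc
    by (elim reach_scan[where m = N and n = L]) (use snoc.prems in \<open>auto simp: add_ac\<close>)
qed

lemma reach_NextC:
  assumes "w = p @ u @ EndStr # r" "EndStr \<notin> set u"
  shows "reach (scan_step v w) (Suc (length u)) (NextC, i, int (length p))
           (RestartY, i - 1, int (length p + length u + 1))"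
  using assms
proof (induction u arbitrary: p)
  case Nil
  then show ?case
    by (intro reach_scan_last[where m = L and n = R]) (auto simp: word_tape_append)
next
  case (Cons a u)
  have "reach (scan_step v w) (length (a # u)) (NextC, i, int (length p) + 1)
          (RestartY, i - 1, int (length p + length (a # u) + 1))"
    using Cons.prems Cons.IH[of "p @ [a]"] by (simp add: add_ac)
  then show ?case
    by (rule reach_scan[where m = N and n = R])
      (use Cons.prems in \<open>auto simp: word_tape_append\<close>)
qed

text \<open>The search for the beginning of the line starts one cell left of the mismatch, because
  the mismatching symbol may itself be \<open>EndStr\<close>. A line is preceded by an
  \<open>EndStr\<close> or, if it is the first one, by a blank.\<close>

lemma reach_RestartY:
  assumes "v = p @ u @ r" "EndStr \<notin> set u" "p = [] \<or> last p = EndStr"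
  shows "reach (scan_step v w) (Suc (length u)) (RestartY, int (length p + length u) - 1, j)
           (Match, int (length p), j)"
  using assms
proof (induction u arbitrary: r rule: rev_induct)
  case Nil
  have "word_tape v (int (length p) - 1) \<in> {Blank, In EndStr}"
  proof (cases "p = []")
    case False
    then obtain p' where "p = p' @ [EndStr]" using Nil by (metis append_butlast_last_id)
    with Nil show ?thesis by (simp add: word_tape_append)
  qed (simp add: word_tape_Blank)
  then show ?case
    by (intro reach_scan_last[where m = R and n = N]) auto
next
  case (snoc a u)
  have "reach (scan_step v w) (Suc (length u)) (RestartY, int (length p + length u) - 1, j)
      (Match, int (length p), j)"
    using snoc.prems by (intro snoc.IH[of "a # r"]) auto
  moreover have "word_tape v (int (length (p @ u))) = In a"
    unfolding snoc.prems(1) using word_tape_append[of "p @ u" a r] by simp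
  ultimately show ?case unfolding length_append_singleton
    by (elim reach_scan[where m = L and n = N]) (use snoc.prems in \<open>auto simp: add_ac\<close>)
qed

lemma reach_Match_prefix:
  assumes "v = p @ u @ r" "w = p' @ u @ r'" "EndStr \<notin> set u" "EndSet \<notin> set u"
  shows "reach (scan_step v w) (length u) (Match, int (length p), int (length p'))
           (Match, int (length p + length u), int (length p' + length u))"
  using assms
proof (induction u arbitrary: p p')
  case Nil
  show ?case by (simp add: reach_refl)
next
  case (Cons a u)
  have "reach (scan_step v w) (length u) (Match, int (length p) + 1, int (length p') + 1)
      (Match, int (length p + length (a # u)), int (length p' + length (a # u)))"
    using Cons.prems Cons.IH[of "p @ [a]" "p' @ [a]"] by (simp add: add_ac)
  then have "reach (scan_step v w) (Suc (length u)) (Match, int (length p), int (length p'))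
      (Match, int (length p + length (a # u)), int (length p' + length (a # u)))"
    by (rule reach_scan[where m = R and n = R])
      (use Cons.prems in \<open>auto simp: word_tape_append\<close>)
  then show ?case by simp
qed

lemma reach_Match_equal:
  assumes "v = p @ a @ EndStr # r" "w = p' @ a @ EndStr # r'" "EndStr \<notin> set a" "EndSet \<notin> set a"
  shows "reach (scan_step v w) (length a + 1) (Match, int (length p), int (length p'))
           (Rewind, int (length p + length a + 1), int (length p' + length a))"
proof -
  have "word_tape v (int (length p + length a)) = In EndStr"
      "word_tape w (int (length p' + length a)) = In EndStr"
    unfolding assms(1,2)
    using word_tape_append[of "p @ a"] word_tape_append[of "p' @ a"] by simp_all
  then show ?thesis
    by (intro reach_trans[OF reach_Match_prefix[OF assms]])
      (auto simp: scan_step add_ac intro!: reach_step[of _ 0, simplified] reach_refl)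
qed

text \<open>The common prefix \<open>u\<close> is read, the rest of \<open>b\<close> is skipped on
  one tape, and \<open>u\<close> is read backwards on the other.\<close>

lemma reach_Match_diff:
  assumes v: "v = p @ a @ EndStr # r" and w: "w = p' @ b @ EndStr # r'"
    and a: "EndStr \<notin> set a" "EndSet \<notin> set a" and b: "EndStr \<notin> set b" "EndSet \<notin> set b"
    and "a \<noteq> b" and p: "p = [] \<or> last p = EndStr"
  shows "reach (scan_step v w) (2 * length a + length b + 3) (Match, int (length p), int (length p'))
           (Match, int (length p), int (length p' + length b + 1))"
proof -
  \<comment> \<open>One line may be a proper prefix of the other, but with the terminator neither
    is, so a first mismatch \<open>s\<close>, \<open>t\<close> exists.\<close>
  have "\<not> prefix (a @ [EndStr]) (b @ [EndStr])" "\<not> prefix (b @ [EndStr]) (a @ [EndStr])"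
    using a b \<open>a \<noteq> b\<close> by (auto simp: prefix_def append_eq_append_conv2 Cons_eq_append_conv
        append_eq_Cons_conv)
  then have "a @ [EndStr] \<parallel> b @ [EndStr]" by blast
  then obtain u s t a' b' where st: "s \<noteq> t"
      and as: "a @ [EndStr] = u @ s # a'" and bs: "b @ [EndStr] = u @ t # b'"
    using parallel_decomp by metis
  obtain a'' where a'': "a = u @ a''" using as
    by (metis append_is_Nil_conv butlast_append butlast_snoc list.distinct(1))
  obtain b'' where b'': "b = u @ b''" using bs
    by (metis append_is_Nil_conv butlast_append butlast_snoc list.distinct(1))
  \<comment> \<open>This rules out the two tests for \<open>EndSet\<close> that \<open>Match\<close>
    makes before it compares.\<close>
  have st': "s \<noteq> EndSet" "t \<noteq> EndSet"
    using as bs a b by (metis UnE empty_iff empty_set in_set_conv_decomp insym.distinct(11) set_ConsD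
        set_append)+
  have "v = (p @ u) @ s # a' @ r" "w = (p' @ u) @ t # b' @ r'"
    using v w as bs by (metis append.assoc append_Cons append_Nil)+
  then have "word_tape v (int (length (p @ u))) = In s" "word_tape w (int (length (p' @ u))) = In t"
    by (simp_all only: word_tape_append)
  then have 2: "reach (scan_step v w) 1 (Match, int (length p + length u), int (length p' + length u))
      (NextC, int (length p + length u), int (length p' + length u))"
    using st st' unfolding One_nat_def by (intro reach_step) (simp add: scan_step reach_refl)
  have 1: "reach (scan_step v w) (length u) (Match, int (length p), int (length p'))
      (Match, int (length p + length u), int (length p' + length u))"
    using v w a a'' b'' by (intro reach_Match_prefix[of _ _ _ "a'' @ EndStr # r" _ _ "b''
        @ EndStr # r'"]) auto
  have 3: "reach (scan_step v w) (Suc (length b''))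
      (NextC, int (length p + length u), int (length p' + length u))
      (RestartY, int (length p + length u) - 1, int (length p' + length b + 1))"
    using reach_NextC[of w "p' @ u" b'' r' v "int (length p + length u)"] w b b'' by
        (simp add: add_ac)
  have 4: "reach (scan_step v w) (Suc (length u))
      (RestartY, int (length p + length u) - 1, int (length p' + length b + 1))
      (Match, int (length p), int (length p' + length b + 1))"
    using v a a'' p by (intro reach_RestartY[of _ _ _ "a'' @ EndStr # r"]) auto
  show ?thesis
    by (rule reach_mono[OF reach_trans[OF reach_trans[OF reach_trans[OF 1 2] 3] 4]])
      (simp add: a'' b'')
qed

lemma reach_Match_fail:
  assumes v: "v = p @ a @ EndStr # r" and w: "w = p' @ lines bs @ s"
    and a: "EndStr \<notin> set a" "EndSet \<notin> set a"
    and bs: "\<And>b. b \<in> set bs \<Longrightarrow> EndStr \<notin> set b \<and> EndSet \<notin> set b \<and> b \<noteq> a"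
    and p: "p = [] \<or> last p = EndStr"
  shows "reach (scan_step v w) (2 * length bs * (length v + length w))
      (Match, int (length p), int (length p'))
           (Match, int (length p), int (length p' + length (lines bs)))"
  using w bs
proof (induction bs arbitrary: p')
  case Nil
  show ?case by (simp add: reach_refl)
next
  case (Cons b bs)
  have 1: "reach (scan_step v w) (2 * length a + length b + 3)
      (Match, int (length p), int (length p'))
      (Match, int (length p), int (length p' + length b + 1))"
    using Cons.prems v a p by (intro reach_Match_diff[of _ _ _ r _ _ _ "lines bs @ s"]) auto
  have 2: "reach (scan_step v w) (2 * length bs * (length v + length w))
      (Match, int (length p), int (length (p' @ b @ [EndStr])))
      (Match, int (length p), int (length (p' @ b @ [EndStr]) + length (lines bs)))"
    using Cons.prems by (intro Cons.IH) auto
  have "2 * length a + length b + 3 \<le> 2 * (length v + length w)"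
    using v Cons.prems by simp
  moreover have "reach (scan_step v w)
      (2 * length a + length b + 3 + 2 * length bs * (length v + length w))
      (Match, int (length p), int (length p'))
      (Match, int (length p), int (length p' + length (lines (b # bs))))"
    using 2 by (intro reach_trans[OF 1]) (simp add: add_ac)
  ultimately show ?case by (elim reach_mono) simp
qed

lemma length_lines: "length bs \<le> length (lines bs)"
  by (induction bs) auto

lemma
  assumes v: "v = p @ a @ EndStr # r" and w: "w = x @ EndSet # lines zs @ [EndSet]"
    and a: "EndStr \<notin> set a" "EndSet \<notin> set a"
    and zs: "\<And>b. b \<in> set zs \<Longrightarrow> EndStr \<notin> set b \<and> EndSet \<notin> set b"
    and p: "p = [] \<or> last p = EndStr"
  defines "k \<equiv> 2 * (length v + length w + 1) * (length w + 1)"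
  shows reach_old_line: "a \<in> set zs \<Longrightarrow>
      reach (scan_step v w) k (Match, int (length p), int (length x + 1))
        (Match, int (length p + length a + 1), int (length x + 1))"
    and reach_new_line: "a \<notin> set zs \<Longrightarrow>
      \<exists>i j. reach (scan_step v w) k (Match, int (length p), int (length x + 1)) (Acc, i, j)"
proof -
  assume "a \<in> set zs"
  \<comment> \<open>Splitting at the first occurrence makes every earlier line differ from
    \<open>a\<close>, as \<open>reach_Match_fail\<close> demands.\<close>
  then obtain bs cs where zs_eq: "zs = bs @ a # cs" and "a \<notin> set bs"
    using split_list_first by metis
  then have w': "w = (x @ [EndSet]) @ lines bs @ a @ EndStr # lines cs @ [EndSet]" using w by simp
  have 1: "reach (scan_step v w) (2 * length bs * (length v + length w))
      (Match, int (length p), int (length (x @ [EndSet])))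
      (Match, int (length p), int (length (x @ [EndSet]) + length (lines bs)))"
    using zs zs_eq \<open>a \<notin> set bs\<close> by (intro reach_Match_fail[OF v w' a _ p]) auto
  have 2: "reach (scan_step v w) (length a + 1)
      (Match, int (length p), int (length (x @ EndSet # lines bs)))
      (Rewind, int (length p + length a + 1), int (length (x @ EndSet # lines bs) + length a))"
    using w' by (intro reach_Match_equal[OF v _ a]) auto
  have 3: "reach (scan_step v w) (length (lines bs @ a) + 2)
      (Rewind, int (length p + length a + 1), int (length x + length (lines bs @ a) + 1))
      (Match, int (length p + length a + 1), int (length x + 1))"
    using w' a zs zs_eq by (intro reach_Rewind[of _ _ _ EndStr]) auto
  have "reach (scan_step v w) (2 * length bs * (length v + length w) + (length a + 1)
      + (length (lines bs @ a) + 2))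
      (Match, int (length p), int (length x + 1))
      (Match, int (length p + length a + 1), int (length x + 1))"
    using 1 2 3 by (intro reach_trans[OF reach_trans]) (auto simp: add_ac)
  moreover have "2 * length bs * (length v + length w) \<le> 2 * length w * (length v + length w)"
    using w' length_lines[of bs] by (intro mult_right_mono) auto
  moreover have "length a + length (lines bs @ a) + 3 \<le> 2 * (length v + length w + 1)"
    using w' v by simp
  ultimately show "reach (scan_step v w) k (Match, int (length p), int (length x + 1))
        (Match, int (length p + length a + 1), int (length x + 1))"
    unfolding k_def by (elim reach_mono) (simp add: algebra_simps)
next
  assume "a \<notin> set zs"
  have w': "w = (x @ [EndSet]) @ lines zs @ [EndSet]" using w by simp
  have 1: "reach (scan_step v w) (2 * length zs * (length v + length w))
      (Match, int (length p), int (length (x @ [EndSet])))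
      (Match, int (length p), int (length (x @ [EndSet]) + length (lines zs)))"
    using zs \<open>a \<notin> set zs\<close> by (intro reach_Match_fail[OF v w' a _ p]) auto
  \<comment> \<open>Covers an empty \<open>a\<close> as well, where the symbol read is
    \<open>EndStr\<close>. Hence \<open>Match\<close> accepts for want of further lines instead of
    rejecting.\<close>
  have "hd (a @ EndStr # r) \<noteq> EndSet" using a by (cases a) auto
  moreover have "word_tape v (int (length p)) = In (hd (a @ EndStr # r))"
    using v word_tape_append[of p "hd (a @ EndStr # r)" "tl (a @ EndStr # r)"] by simp
  moreover have "word_tape w (int (length (x @ [EndSet]) + length (lines zs))) = In EndSet"
    using w' word_tape_append[of "x @ EndSet # lines zs" EndSet "[]"] by simp
  ultimately have "reach (scan_step v w) (Suc 0)
      (Match, int (length p), int (length (x @ [EndSet]) + length (lines zs)))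
      (Acc, int (length p), int (length (x @ [EndSet]) + length (lines zs)))"
    by (intro reach_step) (simp add: scan_step reach_refl)
  from reach_trans[OF 1 this]
  have "reach (scan_step v w) (2 * length zs * (length v + length w) + Suc 0)
      (Match, int (length p), int (length x + 1))
      (Acc, int (length p), int (length (x @ [EndSet]) + length (lines zs)))" by simp
  moreover have "2 * length zs * (length v + length w) \<le> 2 * length w * (length v + length w)"
    using w' length_lines[of zs] by (intro mult_right_mono) auto
  ultimately have "reach (scan_step v w) k
      (Match, int (length p), int (length x + 1))
      (Acc, int (length p), int (length (x @ [EndSet]) + length (lines zs)))"
    unfolding k_def by (elim reach_mono) (simp add: algebra_simps)
  then show "\<exists>i j. reach (scan_step v w) k (Match, int (length p), int (length x + 1)) (Acc, i, j)"
    by blast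
qed

text \<open>Invariant of the outer loop: one head is at the beginning of a line of
  \<open>ys\<close>, the other at the first line of \<open>zs\<close>. A hit restores it for the
  next line, and a miss ends the search.\<close>

lemma reach_decision:
  assumes v: "v = p @ lines ys @ [EndSet]" and w: "w = x @ EndSet # lines zs @ [EndSet]"
    and ys: "\<And>b. b \<in> set ys \<Longrightarrow> EndStr \<notin> set b \<and> EndSet \<notin> set b"
    and zs: "\<And>b. b \<in> set zs \<Longrightarrow> EndStr \<notin> set b \<and> EndSet \<notin> set b"
    and p: "p = [] \<or> last p = EndStr"
  shows "\<exists>i j. reach (scan_step v w) (length ys * (2 * (length v + length w + 1) * (length w + 1))
      + 1)
           (Match, int (length p), int (length x + 1))
           (if set ys \<subseteq> set zs then Rej else Acc, i, j)"
  using v ys p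
proof (induction ys arbitrary: p)
  case Nil
  then have "word_tape v (int (length p)) = In EndSet" by (simp add: word_tape_append)
  then show ?case
    by (auto simp: scan_step intro!: exI reach_step[of _ 0, simplified] reach_refl)
next
  case (Cons a ys)
  define k where "k = 2 * (length v + length w + 1) * (length w + 1)"
  have v': "v = p @ a @ EndStr # lines ys @ [EndSet]" and a: "EndStr \<notin> set a" "EndSet \<notin> set a"
    using Cons.prems by auto
  show ?case unfolding k_def[symmetric]
  proof (cases "a \<in> set zs")
    case True
    have "\<exists>i j. reach (scan_step v w) (length ys * k + 1)
           (Match, int (length (p @ a @ [EndStr])), int (length x + 1))
           (if set ys \<subseteq> set zs then Rej else Acc, i, j)"
      unfolding k_def using Cons.prems by (intro Cons.IH) auto
    then obtain i j where "reach (scan_step v w) (length ys * k + 1)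
           (Match, int (length p + length a + 1), int (length x + 1))
           (if set ys \<subseteq> set zs then Rej else Acc, i, j)" by auto
    from reach_trans[OF reach_old_line[OF v' w a zs Cons.prems(3) True, folded k_def] this] True
    show "\<exists>i j. reach (scan_step v w) (length (a # ys) * k + 1)
        (Match, int (length p), int (length x
          + 1)) (if set (a # ys) \<subseteq> set zs then Rej else Acc, i, j)"
      by (cases "set ys \<subseteq> set zs") (auto simp: add_ac)
  next
    case False
    from reach_new_line[OF v' w a zs Cons.prems(3) False, folded k_def]
    obtain i j where "reach (scan_step v w) k (Match, int (length p), int (length x + 1)) (Acc, i, j)"
      by blast
    then have "reach (scan_step v w) (length (a # ys) * k + 1)
        (Match, int (length p), int (length x + 1)) (Acc, i, j)"
      by (rule reach_mono) simp
    with False show "\<exists>i j. reach (scan_step v w) (length (a # ys) * k + 1)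
        (Match, int (length p), int (length x
          + 1)) (if set (a # ys) \<subseteq> set zs then Rej else Acc, i, j)"
      by auto
  qed
qed

lemma reach_scan_decision:
  assumes v: "v = lines ys @ [EndSet]" and w: "w =
      x @ EndSet # lines zs @ [EndSet]" and x: "EndSet \<notin> set x"
    and ys: "\<And>b. b \<in> set ys \<Longrightarrow> EndStr \<notin> set b \<and> EndSet \<notin> set b"
    and zs: "\<And>b. b \<in> set zs \<Longrightarrow> EndStr \<notin> set b \<and> EndSet \<notin> set b"
    and i: "i < 0 \<Longrightarrow> d = R" "int (length w) \<le> i \<Longrightarrow> d = L"
  shows "\<exists>i' j'. reach (scan_step v w)
           (nat \<bar>i\<bar> + 2 * length w + 6 + length v * (2 * (length v + length w + 1) * (length w + 1)))
           (Seek d, i, i) (if set ys \<subseteq> set zs then Rej else Acc, i', j')"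
proof -
  let ?k = "2 * (length v + length w + 1) * (length w + 1)"
  obtain i' j' where 3: "reach (scan_step v w) (length ys * ?k + 1) (Match, 0, int (length x + 1))
      (if set ys \<subseteq> set zs then Rej else Acc, i', j')"
    using reach_decision[of v "[]" ys w x zs] v w ys zs by auto
  have 1: "reach (scan_step v w) (nat \<bar>i\<bar> + length w + 4) (Seek d, i, i) (Skip, 0, 0)"
    using w i by (intro reach_Seek) auto
  have 2: "reach (scan_step v w) (Suc (length x)) (Skip, 0, 0) (Match, 0, int (length x + 1))"
    using reach_Skip[of w "[]" x "lines zs @ [EndSet]" v 0] w x by simp
  \<comment> \<open>The number of lines is replaced by the length of the output, which the running
    time of \<open>M\<close> controls.\<close>
  have "length ys * ?k \<le> length v * ?k"
    using v length_lines[of ys] by (intro mult_right_mono) auto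
  moreover have "length x \<le> length w" using w by simp
  ultimately have "nat \<bar>i\<bar> + length w + 4 + Suc (length x) + (length ys * ?k + 1)
      \<le> nat \<bar>i\<bar> + 2 * length w + 6 + length v * ?k"
    by linarith
  from reach_mono[OF reach_trans[OF reach_trans[OF 1 2] 3] this] show ?thesis by blast
qed


section \<open>The clock\<close>

text \<open>
  A digit of the clock is a head that sweeps over a marked interval of length \<open>l\<close>, in the
  direction given by a Boolean (\<open>True\<close> for right), and turns around when it has left the interval.
  Its value is the number of moves before it turns around, so that a digit ranges over
  \<open>{0..l}\<close> and turning around is borrowing from the next digit.
\<close>

fun tick :: "bool list \<Rightarrow> sym list \<Rightarrow> (bool list \<times> move list) option" where
  "tick (d # ds) (s # ss) =
     (if s \<noteq> Blank then Some (d # ds, (if d then R else L) # map (\<lambda>_. N) ss)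
      else map_option (\<lambda>(ds', ms). ((\<not> d) # ds', (if d then L else R) # ms)) (tick ds ss))"
| "tick _ _ = None"

text \<open>A head may stand on the one blank cell just beyond the end it is heading for; there its
  digit is 0.\<close>

fun clock_ok :: "nat \<Rightarrow> bool list \<Rightarrow> int list \<Rightarrow> bool" where
  "clock_ok l [] [] \<longleftrightarrow> True"
| "clock_ok l (d # ds) (h # hs) \<longleftrightarrow>
     (if d then 0 \<le> h \<and> h \<le> int l else -1 \<le> h \<and> h < int l) \<and> clock_ok l ds hs"
| "clock_ok l _ _ \<longleftrightarrow> False"

text \<open>The first head is the least significant digit.\<close>

fun clock_value :: "nat \<Rightarrow> bool list \<Rightarrow> int list \<Rightarrow> nat" where
  "clock_value l (d # ds) (h # hs) =
     (if d then nat (int l - h) else nat (h + 1)) + (l + 1) * clock_value l ds hs"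
| "clock_value l _ _ = 0"

lemma tick_length: "tick ds ss = Some (ds', ms) \<Longrightarrow> length ds' = length ds \<and> length ms = length ss"
  by (induction ds ss arbitrary: ds' ms rule: tick.induct) (auto split: if_splits)

lemma tick_Some:
  assumes "clock_ok (length w) ds hs" "clock_value (length w) ds hs > 0"
  shows "\<exists>ds' ms. tick ds (map (word_tape w) hs) = Some (ds', ms) \<and>
    clock_ok (length w) ds' (map2 shift ms hs) \<and>
    Suc (clock_value (length w) ds' (map2 shift ms hs)) = clock_value (length w) ds hs"
  using assms
proof (induction "length w" ds hs rule: clock_ok.induct)
  case (2 d ds h hs)
  show ?case
  proof (cases "word_tape w h = Blank")
    case False
    then have "0 \<le> h" "h < int (length w)" by (auto simp: word_tape_Blank)
    moreover have "map2 shift (map ((\<lambda>_. N) \<circ> word_tape w) hs) hs = hs" by (induction hs) auto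
    ultimately show ?thesis using 2 False by auto
  next
    case True
    then have "h < 0 \<or> int (length w) \<le> h" by (simp add: word_tape_Blank)
    then have h: "h = (if d then int (length w) else -1)" using 2(2) by (auto split: if_splits)
    then have "clock_value (length w) ds hs > 0" using 2 by (auto split: if_splits)
    then obtain ds' ms where *: "tick ds (map (word_tape w) hs) = Some (ds', ms)"
      "clock_ok (length w) ds' (map2 shift ms hs)"
      "Suc (clock_value (length w) ds' (map2 shift ms hs)) = clock_value (length w) ds hs"
      using 2 by auto
    \<comment> \<open>The unit borrowed is worth \<open>length w + 1\<close>. Turning around
      includes a move, after which the digit is \<open>length w\<close>; the remaining 1 is the
      tick.\<close>
    have "(length w + 1) * clock_value (length w) ds hs =
        (length w + 1) * clock_value (length w) ds' (map2 shift ms hs) + length w + 1"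
      unfolding *(3)[symmetric] by simp
    with * True h show ?thesis by (cases d) auto
  qed
qed auto

text \<open>If every digit is 0, every head is on a blank and each borrow is passed on until no
  digit is left.\<close>

lemma tick_None:
  assumes "clock_ok (length w) ds hs" "clock_value (length w) ds hs = 0"
  shows "tick ds (map (word_tape w) hs) = None"
  using assms
  by (induction "length w" ds hs rule: clock_ok.induct) (auto simp: word_tape_Blank split: if_splits)

lemma clock_ok_start: "clock_ok l (replicate k True) (replicate k 0)"
  by (induction k) auto

text \<open>All digits start with their largest value \<open>l\<close>; \<open>Suc\<close> avoids
  subtraction.\<close>

lemma clock_value_start: "Suc (clock_value l (replicate k True) (replicate k 0)) = (l + 1) ^ k"
proof (induction k)
  case (Suc k)
  have "(l + 1) ^ Suc k = (l + 1) * Suc (clock_value l (replicate k True) (replicate k 0))"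
    using Suc by simp
  then show ?case by simp
qed simp


section \<open>Turing machines\<close>

lemma act_read: "act (read t, N) t = t"
  by (cases t) (simp add: act_def read_def)

lemma map2_act_stay: "map2 act (map (\<lambda>s. (s, N)) (map read ts)) ts = ts"
  by (induction ts) (auto simp: act_read)

lemma run_Suc: "run M w (Suc t) = step M (run M w t)"
  by (simp add: run_def)

lemma step_halted: "halted M c \<Longrightarrow> step M c = c"
  by (simp add: step_def)

lemma run_halted_mono:
  assumes "halted M (run M w s)" "s \<le> t"
  shows "run M w t = run M w s"
  using assms(2,1) by (induction rule: dec_induct) (auto simp: run_Suc step_halted)

text \<open>\<open>wf_tm\<close> restricts \<open>delta\<close> only on proper states and on symbol
  lists of the right length over the tape alphabet; this invariant keeps runs there.\<close>

definition wf_config :: "'q tm \<Rightarrow> 'q config \<Rightarrow> bool" where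
  "wf_config M c \<longleftrightarrow> fst c \<in> states M \<and> length (snd c) = num_tapes M \<and>
     (\<forall>t \<in> set (snd c). range (fst t) \<subseteq> tape_alphabet M)"

lemma wf_config_init: "wf_tm M \<Longrightarrow> wf_config M (init M w)"
  by (auto simp: wf_tm_def wf_config_def init_def word_tape_def image_subset_iff)

lemma wf_delta:
  assumes M: "wf_tm M" and q: "q \<in> states M" "q \<noteq> accept M" "q \<noteq> reject M"
    and ss: "length ss = num_tapes M" "set ss \<subseteq> tape_alphabet M" and d: "delta M q ss = (q', as)"
  shows "q' \<in> states M" "length as = num_tapes M" "fst ` set as \<subseteq> tape_alphabet M"
proof -
  have *: "\<forall>q \<in> states M - {accept M, reject M}. \<forall>ss.
      length ss = num_tapes M \<and> set ss \<subseteq> tape_alphabet M \<longrightarrow>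
      (case delta M q ss of (q', as) \<Rightarrow>
        q' \<in> states M \<and> length as = num_tapes M \<and> fst ` set as \<subseteq> tape_alphabet M)"
    using M unfolding wf_tm_def by (elim conjE)
  have "q \<in> states M - {accept M, reject M}" using q by simp
  from bspec[OF * this, THEN spec, of ss] ss d show "q' \<in> states M" "length as =
      num_tapes M" "fst ` set as \<subseteq> tape_alphabet M"
    by simp_all
qed

lemma wf_delta_config:
  assumes "wf_tm M" "wf_config M (q, ts)" "\<not> halted M (q, ts)" "delta M q (map read ts) = (q', as)"
  shows "q' \<in> states M" "length as = num_tapes M" "fst ` set as \<subseteq> tape_alphabet M"
proof -
  have q: "q \<in> states M" "q \<noteq> accept M" "q \<noteq> reject M" and len: "length (map read ts) = num_tapes M"
    using assms by (auto simp: wf_config_def halted_def)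
  have "read t \<in> tape_alphabet M" if "t \<in> set ts" for t
    using assms(2) that by (cases t) (force simp: wf_config_def read_def)
  then have "set (map read ts) \<subseteq> tape_alphabet M" by auto
  note wf_delta[OF assms(1) q len this assms(4)]
  then show "q' \<in> states M" "length as = num_tapes M" "fst ` set as \<subseteq> tape_alphabet M"
    by simp_all
qed

lemma step_delta:
  "\<not> halted M (q, ts) \<Longrightarrow> delta M q (map read ts) = (q', as) \<Longrightarrow> step M (q, ts) = (q', map2 act as ts)"
  by (simp add: step_def)

lemma wf_config_step:
  assumes "wf_tm M" "wf_config M c"
  shows "wf_config M (step M c)"
proof (cases "halted M c")
  case False
  obtain q ts q' as where c: "c = (q, ts)" and d: "delta M q (map read ts) = (q', as)"
    by (metis surj_pair)
  note wf = wf_delta_config[OF assms(1) assms(2)[unfolded c] False[unfolded c] d]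
  have "fst (act a t) i \<in> tape_alphabet M" if "(a, t) \<in> set (zip as ts)" for a t i
    using that wf(3) assms(2) set_zip_leftD[OF that] set_zip_rightD[OF that]
    by (cases a; cases t) (fastforce simp: c wf_config_def act_def)
  then show ?thesis
    using wf assms(2) step_delta[OF False[unfolded c] d] by (auto simp: c wf_config_def)
qed (use assms step_halted in metis)

lemma wf_config_run: "wf_tm M \<Longrightarrow> wf_config M (run M w t)"
  by (induction t) (simp add: run_def wf_config_init, simp add: run_Suc wf_config_step)

text \<open>A machine writes at most one cell of its output tape per step.\<close>

lemma output_tape_bound:
  assumes "wf_tm M"
  shows "\<bar>snd (snd (run M w t) ! 1)\<bar> \<le> int t \<and>
    (\<forall>i. fst (snd (run M w t) ! 1) i \<noteq> Blank \<longrightarrow> i < int t)"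
proof (induction t)
  case 0
  have "1 < num_tapes M" using assms by (simp add: wf_tm_def)
  then show ?case by (simp add: run_def init_def)
next
  case (Suc t)
  show ?case
  proof (cases "halted M (run M w t)")
    case True
    with Suc show ?thesis by (auto simp: run_Suc step_halted)
  next
    case False
    obtain q ts q' as where c: "run M w t = (q, ts)" and d: "delta M q (map read ts) = (q', as)"
      by (metis surj_pair)
    obtain T h where T: "ts ! 1 = (T, h)" by fastforce
    obtain s m where s: "as ! 1 = (s, m)" by fastforce
    note wfc = wf_config_run[OF assms, of w t, unfolded c]
    have "length as = num_tapes M" "length ts = num_tapes M" "1 < num_tapes M"
      using wf_delta_config[OF assms wfc False[unfolded c] d] wfc assms
      by (auto simp: wf_tm_def wf_config_def)
    then have "snd (run M w (Suc t)) ! 1 = (T(h := s), shift m h)"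
      using step_delta[OF False[unfolded c] d] T s by (simp add: run_Suc c act_def)
    moreover have "\<bar>h\<bar> \<le> int t" "\<forall>i. T i \<noteq> Blank \<longrightarrow> i < int t" using Suc c T by auto
    moreover have "\<bar>shift m h\<bar> \<le> \<bar>h\<bar> + 1" by (cases m) auto
    ultimately show ?thesis by (auto simp: le_less_Suc_eq intro: less_trans[of _ "int t"])
  qed
qed


section \<open>The machine for Another MCS\<close>

text \<open>
  The tapes are those of \<open>M\<close>, followed by \<open>k + 1\<close> tapes to which the input \<open>x @ z\<close> is copied. Then
  \<open>z\<close> is erased from the input tape and \<open>M\<close> is simulated. The first of the copies is moved in
  lockstep with the output tape of \<open>M\<close>, which makes it possible to find the beginning of the output
  (\<open>Sim\<close> remembers in which direction it is); the other copies are the digits of the clock.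
\<close>

datatype 'q st = Copy | Erase | Home | Sim 'q move "bool list" | Scan scan

text \<open>Countability allows the states of the constructed machine to be renamed to natural
  numbers.\<close>

instance move :: countable by countable_datatype
instance scan :: countable by countable_datatype
instance st :: (countable) countable by countable_datatype

text \<open>A head that has just left the word finds it again in the direction opposite to its last
  move.\<close>

fun opposite :: "move \<Rightarrow> move" where
  "opposite L = R"
| "opposite N = N"
| "opposite R = L"

text \<open>Common shape of the three preparation phases, so that one lemma computes their steps:
  only tape 0 among the tapes of \<open>M\<close> is touched, and all copies are treated
  alike.\<close>

definition prelim_acts :: "nat \<Rightarrow> sym \<times> move \<Rightarrow> (sym \<Rightarrow> sym \<times> move) \<Rightarrow> sym list \<Rightarrow> (sym \<times> move) list" where
  "prelim_acts m a f ss = a # map (\<lambda>s. (s, N)) (take (m - 1) (tl ss)) @ map f (drop m ss)"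

text \<open>\<open>Home\<close> is steered by the first copy, since the input tape is already blank
  beyond \<open>x\<close>. In \<open>Sim\<close> halting is tested before the clock, and the
  direction changes only while the accompanying head is on the word.\<close>

fun other_delta :: "'q tm \<Rightarrow> nat \<Rightarrow> 'q st \<Rightarrow> sym list \<Rightarrow> 'q st \<times> (sym \<times> move) list" where
  "other_delta M k Copy ss =
     (if hd ss = In EndSet then Erase else Copy,
      prelim_acts (num_tapes M) (hd ss, R) (\<lambda>_. (hd ss, R)) ss)"
| "other_delta M k Erase ss =
     (if hd ss = Blank then (Home, prelim_acts (num_tapes M) (Blank, L) (\<lambda>s. (s, L)) ss)
      else (Erase, prelim_acts (num_tapes M) (Blank, R) (\<lambda>_. (hd ss, R)) ss))"
| "other_delta M k Home ss =
     (if ss ! num_tapes M = Blank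
      then (Sim (start M) N (replicate k True), prelim_acts (num_tapes M) (hd ss, R) (\<lambda>s. (s, R)) ss)
      else (Home, prelim_acts (num_tapes M) (hd ss, L) (\<lambda>s. (s, L)) ss))"
| "other_delta M k (Sim q d ds) ss =
     (if q = accept M \<or> q = reject M then (Scan (Seek d), map (\<lambda>s. (s, N)) ss)
      else case tick ds (drop (Suc (num_tapes M)) ss) of
        None \<Rightarrow> (Scan Acc, map (\<lambda>s. (s, N)) ss)
      | Some (ds', ms) \<Rightarrow> (case delta M q (take (num_tapes M) ss) of (q', as) \<Rightarrow>
          (Sim q' (if ss ! num_tapes M = Blank then d else opposite (snd (as ! 1))) ds',
           as @ (ss ! num_tapes M, snd (as ! 1)) # zip (drop (Suc (num_tapes M)) ss) ms)))"
| "other_delta M k (Scan s) ss =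
     (case scan_move s (ss ! 1) (ss ! num_tapes M) of (s', m, n) \<Rightarrow>
       (Scan s', (map (\<lambda>s. (s, N)) ss)[1 := (ss ! 1, m), num_tapes M := (ss ! num_tapes M, n)]))"

text \<open>Fixing the length of the direction lists keeps the state set finite. No new tape symbols
  are needed, because the clock uses the blanks around the copies as marks.\<close>

definition other_tm :: "'q tm \<Rightarrow> nat \<Rightarrow> 'q st tm" where
  "other_tm M k = \<lparr>num_tapes = num_tapes M + Suc k,
     states = {Copy, Erase, Home} \<union> {Sim q d ds | q d ds. q \<in> states M \<and> length ds = k} \<union> range Scan,
     tape_alphabet = tape_alphabet M, start = Copy, accept = Scan Acc, reject = Scan Rej,
     delta = other_delta M k\<rparr>"

lemma other_tm_simps [simp]:
  "num_tapes (other_tm M k) = num_tapes M + Suc k" "tape_alphabet (other_tm M k) = tape_alphabet M"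
  "start (other_tm M k) = Copy" "accept (other_tm M k) = Scan Acc" "reject (other_tm M k) = Scan Rej"
  "delta (other_tm M k) = other_delta M k"
  by (simp_all add: other_tm_def)

lemma length_prelim_acts:
  "0 < m \<Longrightarrow> length ss = m + n \<Longrightarrow> length (prelim_acts m a f ss) = length ss"
  by (cases ss) (auto simp: prelim_acts_def)

lemma set_prelim_acts:
  "fst ` set (prelim_acts m a f ss) \<subseteq> insert (fst a) (set ss \<union> (fst \<circ> f) ` set ss)"
proof -
  have "fst ` set (prelim_acts m a f ss) =
      insert (fst a) (set (take (m - 1) (tl ss)) \<union> (fst \<circ> f) ` set (drop m ss))"
    by (simp add: prelim_acts_def image_Un image_image comp_def)
  moreover have "set (take (m - 1) (tl ss)) \<subseteq> set ss" by (cases ss) (auto dest: in_set_takeD)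
  ultimately show ?thesis using set_drop_subset[of m ss] by auto
qed

lemma finite_move: "finite (UNIV :: move set)"
proof -
  have "UNIV = {L, N, R}" by (auto intro: move.exhaust)
  then show ?thesis by (metis finite.emptyI finite.insertI)
qed

lemma finite_scan: "finite (UNIV :: scan set)"
proof (rule finite_subset)
  show "UNIV \<subseteq> range Seek \<union> {Back, Skip, Match, NextC, RestartY, Rewind, Acc, Rej}"
  proof
    fix q show "q \<in> range Seek \<union> {Back, Skip, Match, NextC, RestartY, Rewind, Acc, Rej}"
      by (cases q) auto
  qed
qed (simp add: finite_move)

lemma finite_states_other:
  assumes "finite (states M)"
  shows "finite (states (other_tm M k))"
proof -
  have "{Sim q d ds | q d ds. q \<in> states M \<and> length ds = k} \<subseteq>
      (\<lambda>(q, d, ds). Sim q d ds) ` (states M \<times> UNIV \<times> {ds. set ds \<subseteq> UNIV \<and> length ds = k})"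
    by (force simp: image_iff)
  then have "finite {Sim q d ds | q d ds. q \<in> states M \<and> length ds = k}"
    by (rule finite_subset)
      (intro finite_imageI finite_cartesian_product finite_lists_length_eq assms finite_move finite)
  then show ?thesis using finite_scan by (simp add: other_tm_def)
qed

lemma wf_other_delta:
  assumes M: "wf_tm M" and q: "q \<in> states (other_tm M k)"
    and ss: "length ss = num_tapes M + Suc k" "set ss \<subseteq> tape_alphabet M"
    and d: "other_delta M k q ss = (q', as)"
  shows "q' \<in> states (other_tm M k) \<and> length as = num_tapes M + Suc k \<and>
    fst ` set as \<subseteq> tape_alphabet M"
proof -
  let ?m = "num_tapes M"
  have m: "2 \<le> ?m" and blank: "Blank \<in> tape_alphabet M" using M by (auto simp: wf_tm_def)
  have hd: "hd ss \<in> tape_alphabet M" using ss by (cases ss) auto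
  have nth: "ss ! i \<in> tape_alphabet M" if "i \<le> ?m" for i using ss that by (auto simp: subset_iff)
  define good :: "(sym \<times> move) list \<Rightarrow> bool" where
    "good as \<longleftrightarrow> length as = ?m + Suc k \<and> fst ` set as \<subseteq> tape_alphabet M" for as
  have prelim: "good (prelim_acts ?m (s, d) f ss)"
    if "s \<in> tape_alphabet M" "\<And>s. s \<in> set ss \<Longrightarrow> fst (f s) \<in> tape_alphabet M" for s d f
    using length_prelim_acts[of ?m ss "Suc k" "(s, d)" f] set_prelim_acts[of ?m "(s, d)" f ss] that
        ss m
    by (auto simp: good_def)
  have stay: "good (map (\<lambda>s. (s, N)) ss)"
    using ss by (auto simp: good_def image_image)
  have "q' \<in> states (other_tm M k) \<and> good as"
  proof (cases q)
    case Copy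
    then show ?thesis using d prelim hd by (auto simp: other_tm_def split: if_splits)
  next
    case Erase
    then show ?thesis using d prelim hd blank ss
      by (auto simp: other_tm_def subset_iff split: if_splits)
  next
    case Home
    then show ?thesis using d prelim hd ss M
      by (auto simp: other_tm_def subset_iff wf_tm_def split: if_splits)
  next
    case (Sim p dir ds)
    then have p: "p \<in> states M" "length ds = k" using q by (auto simp: other_tm_def)
    consider "p = accept M \<or> p = reject M" | "p \<noteq> accept M" "p \<noteq> reject M" "tick ds (drop (Suc ?m)
        ss) = None"
      | ds' ms where "p \<noteq> accept M" "p \<noteq> reject M" "tick ds (drop (Suc ?m) ss) = Some (ds', ms)"
      by fastforce
    then show ?thesis
    proof cases
      case 3
      obtain p' bs where dM: "delta M p (take ?m ss) = (p', bs)" by fastforce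
      have "set (take ?m ss) \<subseteq> tape_alphabet M" "length (take ?m ss) = ?m"
        using ss by (auto dest: in_set_takeD)
      then have "p' \<in> states M" "length bs = ?m" and bs: "fst ` set bs \<subseteq> tape_alphabet M"
        using wf_delta[OF M _ _ _ _ _ dM] p 3 by auto
      moreover have "s \<in> tape_alphabet M" if "(s, m) \<in> set bs" for s m
        using subsetD[OF bs imageI[OF that]] by simp
      moreover have "s \<in> tape_alphabet M" if "(s, m) \<in> set (zip (drop (Suc ?m) ss) ms)" for s m
        using ss set_zip_leftD[OF that] by (auto dest: in_set_dropD)
      moreover have "length ds' = k" "length ms = k" using tick_length[OF 3(3)] p ss by auto
      ultimately show ?thesis using d Sim 3 dM ss nth[of ?m]
        by (auto simp: other_tm_def good_def)
    qed (use d Sim stay in \<open>auto simp: other_tm_def\<close>)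
  next
    case (Scan s)
    obtain s' m n where "scan_move s (ss ! 1) (ss ! ?m) = (s', m, n)" by (metis surj_pair)
    then have q': "q' = Scan s'"
      and as: "as = (map (\<lambda>s. (s, N)) ss)[1 := (ss ! 1, m), ?m := (ss ! ?m, n)]"
      using d Scan by auto
    have "set as \<subseteq> insert (ss ! ?m, n) (insert (ss ! 1, m) (set (map (\<lambda>s. (s, N)) ss)))"
      unfolding as by (meson insert_mono order_trans set_update_subset_insert)
    then have "fst ` set as \<subseteq> insert (ss ! ?m) (insert (ss ! 1) (set ss))" by force
    then show ?thesis using ss nth[of 1] nth[of ?m] \<open>2 \<le> ?m\<close> q' as
      by (auto simp: other_tm_def good_def)
  qed
  then show ?thesis by (simp add: good_def)
qed

lemma wf_other_tm:
  assumes "wf_tm M"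
  shows "wf_tm (other_tm M k)"
proof -
  have "case delta (other_tm M k) q ss of (q', as) \<Rightarrow>
      q' \<in> states (other_tm M k) \<and> length as = num_tapes (other_tm M k) \<and>
      fst ` set as \<subseteq> tape_alphabet (other_tm M k)"
    if "q \<in> states (other_tm M k)" "length ss = num_tapes (other_tm M k)"
      "set ss \<subseteq> tape_alphabet (other_tm M k)" for q ss
    using wf_other_delta[OF assms that(1), of ss] that by (cases "other_delta M k q ss") auto
  moreover have "start (other_tm M k) \<in> states (other_tm M k)"
    "accept (other_tm M k) \<in> states (other_tm M k)" "reject (other_tm M k) \<in> states (other_tm M k)"
    by (auto simp: other_tm_def)
  ultimately show ?thesis
    using assms finite_states_other[of M k] unfolding wf_tm_def by auto
qed


section \<open>Correctness of the machine\<close>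

subsection \<open>Preparing the tapes\<close>

lemma not_halted_other [simp]:
  "\<not> halted (other_tm M k) (Copy, ts)" "\<not> halted (other_tm M k) (Erase, ts)"
  "\<not> halted (other_tm M k) (Home, ts)" "\<not> halted (other_tm M k) (Sim q d ds, ts)"
  by (simp_all add: halted_def)

lemma step_other_prelim:
  assumes "q \<in> {Copy, Erase, Home}" "Suc (length ts) = num_tapes M"
    and "other_delta M k q (map read ((T, h) # ts @ replicate (Suc k) (T', h'))) =
      (q', prelim_acts (num_tapes M) (s, m) (\<lambda>s. (f s, m')) (map read ((T, h) #
        ts @ replicate (Suc k) (T', h'))))"
  shows "step (other_tm M k) (q, (T, h) # ts @ replicate (Suc k) (T', h')) =
    (q', (T(h := s), shift m h) # ts @ replicate (Suc k) (T'(h' := f (T' h')), shift m' h'))"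
proof -
  have *: "map2 act (replicate j a) (replicate j t) = replicate j (act a t)" for j a t
    by (induction j) auto
  have "num_tapes M = Suc (length ts)" using assms(2) by simp
  then have "prelim_acts (num_tapes M) (s, m) (\<lambda>s. (f s, m')) (map read ((T, h) #
      ts @ replicate (Suc k) (T', h'))) =
      (s, m) # map (\<lambda>s. (s, N)) (map read ts) @ replicate (Suc k) (f (T' h'), m')"
    by (simp add: prelim_acts_def read_def del: replicate_Suc)
  then have "map2 act (prelim_acts (num_tapes M) (s, m) (\<lambda>s. (f s, m')) (map read ((T, h) #
      ts @ replicate (Suc k) (T', h'))))
      ((T, h) # ts @ replicate (Suc k) (T', h')) =
      act (s, m) (T, h) # map2 act (map (\<lambda>s. (s, N)) (map read ts)) ts @
      map2 act (replicate (Suc k) (f (T' h'), m')) (replicate (Suc k) (T', h'))"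
    by (simp only: zip_Cons_Cons list.map zip_append length_map map_append split)
  also have "\<dots> = (T(h := s), shift m h) # ts @ replicate (Suc k) (T'(h' := f (T' h')), shift m' h')"
    unfolding * map2_act_stay by (simp add: act_def)
  finally show ?thesis
    using assms(1,3) by (auto simp: step_def simp del: replicate_Suc)
qed

lemma word_tape_snoc: "(word_tape p)(int (length p) := In s) = word_tape (p @ [s])"
  by (rule ext) (auto simp: word_tape_def nth_append)

lemma reach_Copy:
  assumes "w = p @ u @ EndSet # r" "EndSet \<notin> set u" "Suc (length ts) = num_tapes M"
  shows "reach (step (other_tm M k)) (Suc (length u))
    (Copy, (word_tape w, int (length p)) # ts @ replicate (Suc k) (word_tape p, int (length p)))
    (Erase, (word_tape w, int (length (p @ u @ [EndSet]))) # ts @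
       replicate (Suc k) (word_tape (p @ u @ [EndSet]), int (length (p @ u @ [EndSet]))))"
  using assms(1,2)
proof (induction u arbitrary: p)
  case Nil
  then have w: "word_tape w (int (length p)) = In EndSet" by (simp add: word_tape_append)
  then have "(word_tape w)(int (length p) := In EndSet) = word_tape w" by (rule fun_upd_idem)
  with w show ?case
    by (intro reach_step, subst step_other_prelim[where f = "\<lambda>_. In EndSet" and s =
        "In EndSet" and m = R and m' = R and q' = Erase])
      (auto simp: assms(3) read_def word_tape_snoc add_ac reach_refl simp del: replicate_Suc)
next
  case (Cons a u)
  then have w: "word_tape w (int (length p)) = In a" by (simp add: word_tape_append)
  then have "(word_tape w)(int (length p) := In a) = word_tape w" by (rule fun_upd_idem)
  with w have "step (other_tm M k) (Copy, (word_tape w, int (length p)) #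
      ts @ replicate (Suc k) (word_tape p, int (length p))) =
      (Copy, (word_tape w, int (length (p @ [a]))) #
        ts @ replicate (Suc k) (word_tape (p @ [a]), int (length (p @ [a]))))"
    using Cons.prems
    by (subst step_other_prelim[where f = "\<lambda>_. In a" and s = "In a" and m = R and m' = R and q' =
        Copy])
      (auto simp: assms(3) read_def word_tape_snoc add_ac simp del: replicate_Suc)
  then show ?case using Cons.IH[of "p @ [a]"] Cons.prems
    unfolding list.size add_Suc_right add_0_right
    by (intro reach_step[of _ "Suc _"]) (simp del: replicate_Suc add: add_ac)
qed

text \<open>The input tape while the second list is being erased: what lies below \<open>n\<close>
  and beyond \<open>x\<close> is blank already.\<close>

definition splice :: "int \<Rightarrow> insym list \<Rightarrow> insym list \<Rightarrow> int \<Rightarrow> sym" where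
  "splice n x w i = (if i < n then word_tape x i else word_tape w i)"

lemma splice_Blank:
  "int (length x) \<le> n \<Longrightarrow> (splice n x w)(n := Blank) = splice (n + 1) x w"
  by (rule ext) (auto simp: splice_def word_tape_def)

lemma splice_start: "splice (int (length x)) x (x @ z) = word_tape (x @ z)"
  by (rule ext) (auto simp: splice_def word_tape_def nth_append)

lemma splice_end:
  "length x \<le> length w \<Longrightarrow> splice (int (length w)) x w = word_tape x"
  by (rule ext) (auto simp: splice_def word_tape_def)

lemma reach_Erase:
  assumes "w = p @ r" "length x \<le> length p" "Suc (length ts) = num_tapes M"
  shows "reach (step (other_tm M k)) (Suc (length r))
    (Erase, (splice (int (length p)) x w, int (length p)) #
      ts @ replicate (Suc k) (word_tape p, int (length p)))
    (Home, (word_tape x, int (length w) - 1) #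
      ts @ replicate (Suc k) (word_tape w, int (length w) - 1))"
  using assms(1,2)
proof (induction r arbitrary: p)
  case Nil
  have "word_tape p (int (length p)) = Blank" "word_tape x (int (length p)) = Blank"
    using Nil by (auto simp: word_tape_Blank)
  then show ?case using Nil
    by (intro reach_step, subst step_other_prelim[where f = "\<lambda>s. s" and s = Blank and m = L and m' =
        L and q' = Home])
      (auto simp: assms(3) read_def splice_end fun_upd_idem reach_refl simp del: replicate_Suc)
next
  case (Cons a r)
  then have w: "splice (int (length p)) x w (int (length p)) = In a"
    by (simp add: word_tape_append splice_def)
  then have "step (other_tm M k) (Erase, (splice (int (length p)) x w, int (length p)) #
      ts @ replicate (Suc k) (word_tape p, int (length p))) =
      (Erase, (splice (int (length (p @ [a]))) x w, int (length (p @ [a]))) #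
        ts @ replicate (Suc k) (word_tape (p @ [a]), int (length (p @ [a]))))"
    using Cons.prems
    by (subst step_other_prelim[where f = "\<lambda>_. In a" and s = Blank and m = R and m' = R and q' =
        Erase])
      (auto simp: assms(3) read_def word_tape_snoc splice_Blank add_ac simp del: replicate_Suc)
  then show ?case using Cons.IH[of "p @ [a]"] Cons.prems
    unfolding list.size add_Suc_right add_0_right
    by (intro reach_step[of _ "Suc _"]) (simp del: replicate_Suc add: add_ac)
qed

lemma reach_Home:
  assumes "-1 \<le> i" "i < int (length w)" "Suc (length ts) = num_tapes M"
  shows "reach (step (other_tm M k)) (nat i + 2)
    (Home, (T, i) # ts @ replicate (Suc k) (word_tape w, i))
    (Sim (start M) N (replicate k True), (T, 0) # ts @ replicate (Suc k) (word_tape w, 0))"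
proof -
  have nth: "map read ((T, i) # ts @ replicate (Suc k) (word_tape w, i)) ! num_tapes M =
      word_tape w i" for i
    unfolding assms(3)[symmetric] by (simp add: nth_append read_def)
  have 0: "reach (step (other_tm M k)) (Suc 0)
      (Home, (T, -1) # ts @ replicate (Suc k) (word_tape w, -1))
    (Sim (start M) N (replicate k True), (T, 0) # ts @ replicate (Suc k) (word_tape w, 0))"
    using nth[of "-1"]
    by (intro reach_step, subst step_other_prelim[where f = "\<lambda>s. s" and s = "T (-1)" and m =
        R and m' = R
          and q' = "Sim (start M) N (replicate k True)"])
      (auto simp: assms(3) read_def word_tape_Blank reach_refl simp del: replicate_Suc)
  have step: "step (other_tm M k) (Home, (T, int n) # ts @ replicate (Suc k) (word_tape w, int n)) =
      (Home, (T, int n - 1) # ts @ replicate (Suc k) (word_tape w, int n - 1))" if "n < length w"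
        for n
    using nth[of "int n"] that
    by (subst step_other_prelim[where f = "\<lambda>s. s" and s = "T (int n)" and m = L and m' = L and q' =
        Home])
      (auto simp: assms(3) read_def word_tape_Blank simp del: replicate_Suc)
  have "reach (step (other_tm M k)) (n + 2)
    (Home, (T, int n) # ts @ replicate (Suc k) (word_tape w, int n))
    (Sim (start M) N (replicate k True), (T, 0) # ts @ replicate (Suc k) (word_tape w, 0))"
    if "n < length w" for n
    using that
  proof (induction n)
    case 0
    show ?case unfolding add_2_eq_Suc'
      by (rule reach_step, subst step) (use 0 \<open>reach _ (Suc 0) _ _\<close> in \<open>simp_all del: replicate_Suc\<close>)
  next
    case (Suc n)
    then show ?case unfolding add_Suc
      by (intro reach_step[of _ "n + 2"]) (subst step, simp_all del: replicate_Suc)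
  qed
  from this[of "nat i"] reach_mono[OF 0] show ?thesis
    using assms by (cases "i = -1") (auto simp del: replicate_Suc)
qed

lemma reach_prelim:
  assumes "x = u @ [EndSet]" "EndSet \<notin> set u" "num_tapes M \<ge> 1"
  shows "reach (step (other_tm M k)) (2 * length (x @ z) + 2) (init (other_tm M k) (x @ z))
    (Sim (start M) N (replicate k True), snd (init M x) @ replicate (Suc k) (word_tape (x @ z), 0))"
proof -
  define ts :: "tape list" where "ts = replicate (num_tapes M - 1) (\<lambda>_. Blank, 0)"
  have ts: "Suc (length ts) = num_tapes M" using assms(3) by (simp add: ts_def)
  have Nil: "word_tape [] = (\<lambda>_. Blank)" by (rule ext) (simp add: word_tape_def)
  have init: "init (other_tm M k) (x @ z) = (Copy, (word_tape (x @ z), 0) #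
      ts @ replicate (Suc k) (word_tape [], 0))"
    using assms(3) unfolding Nil
    by (simp add: init_def ts_def replicate_add[symmetric] del: replicate_Suc)
  have 1: "reach (step (other_tm M k)) (Suc (length u)) (init (other_tm M k) (x @ z))
      (Erase, (splice (int (length x)) x (x @ z), int (length x)) #
        ts @ replicate (Suc k) (word_tape x, int (length x)))"
    unfolding init splice_start using reach_Copy[of "x @ z" "[]" u z ts M k] assms ts by simp
  have 2: "reach (step (other_tm M k)) (Suc (length z))
      (Erase, (splice (int (length x)) x (x @ z), int (length x)) #
        ts @ replicate (Suc k) (word_tape x, int (length x)))
      (Home, (word_tape x, int (length (x @ z)) - 1) #
        ts @ replicate (Suc k) (word_tape (x @ z), int (length (x @ z)) - 1))"
    by (intro reach_Erase ts) auto
  have 3: "reach (step (other_tm M k)) (nat (int (length (x @ z)) - 1) + 2)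
      (Home, (word_tape x, int (length (x @ z)) - 1) #
        ts @ replicate (Suc k) (word_tape (x @ z), int (length (x @ z)) - 1))
      (Sim (start M) N (replicate k True), (word_tape x, 0) #
        ts @ replicate (Suc k) (word_tape (x @ z), 0))"
    by (intro reach_Home ts) (auto simp: assms(1))
  show ?thesis
    using reach_mono[OF reach_trans[OF reach_trans[OF 1 2] 3], of "2 * length (x @ z) + 2"] assms(1)
    by (simp add: init_def ts_def)
qed


subsection \<open>The simulation\<close>

text \<open>Invariant of the simulation: the tapes of \<open>M\<close> are exactly those of its own
  run, the accompanying head has the position of the output head, \<open>d\<close> leads back to the
  word, and elapsed time plus clock value is constant.\<close>

definition sim_config :: "'q tm \<Rightarrow> nat \<Rightarrow> insym list \<Rightarrow> insym list \<Rightarrow> nat \<Rightarrow> 'q st config \<Rightarrow> bool" where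
  "sim_config M k x w t c \<longleftrightarrow> (\<exists>q ts d ds hs.
     run M x t = (q, ts) \<and>
     c = (Sim q d ds, ts @ (word_tape w, snd (ts ! 1)) # map (\<lambda>h. (word_tape w, h)) hs) \<and>
     (snd (ts ! 1) < 0 \<longrightarrow> d = R) \<and> (int (length w) \<le> snd (ts ! 1) \<longrightarrow> d = L) \<and>
     length hs = k \<and> clock_ok (length w) ds hs \<and>
     Suc (clock_value (length w) ds hs) + t = (length w + 1) ^ k)"

lemma map2_act_zip:
  "length ms = length hs \<Longrightarrow> map2 act (zip (map T hs) ms) (map (\<lambda>h. (T, h)) hs) =
    map (\<lambda>h. (T, h)) (map2 shift ms hs)"
  by (induction ms hs rule: list_induct2) (auto simp: act_def)

lemma sim_config_start:
  assumes "wf_tm M" "w \<noteq> []"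
  shows "sim_config M k x w 0
    (Sim (start M) N (replicate k True), snd (init M x) @ replicate (Suc k) (word_tape w, 0))"
proof -
  have "snd (snd (init M x) ! 1) = 0" using assms(1) by (simp add: init_def wf_tm_def)
  then show ?thesis using assms(2)
    unfolding sim_config_def
    by (intro exI[of _ "start M"] exI[of _ "snd (init M x)"] exI[of _ N] exI[of _ "replicate k True"]
        exI[of _ "replicate k 0"])
      (auto simp: run_def clock_ok_start clock_value_start init_def)
qed

lemma sim_step_delta:
  assumes q: "q \<noteq> accept M" "q \<noteq> reject M" and ts: "length ts = num_tapes M"
    and hs: "length hs = k"
    and c_def: "c = (Sim q d ds, ts @ (word_tape w, h) # map (\<lambda>h. (word_tape w, h)) hs)"
  shows "tick ds (map (word_tape w) hs) = None \<Longrightarrow> step (other_tm M k) c = (Scan Acc, snd c)"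
    and "\<And>ds' ms q' as. tick ds (map (word_tape w) hs) = Some (ds', ms) \<Longrightarrow> delta M q (map read ts) =
        (q', as) \<Longrightarrow>
      length as = num_tapes M \<Longrightarrow>
      step (other_tm M k) c = (Sim q' (if word_tape w h =
          Blank then d else opposite (snd (as ! 1))) ds',
        map2 act as ts @ (word_tape w, shift (snd (as ! 1)) h) # map (\<lambda>h. (word_tape w, h)) (map2
            shift ms hs))"
proof -
  have *: "map read (snd c) ! num_tapes M = word_tape w h" "take (num_tapes M) (map read (snd c)) =
      map read ts"
    "drop (Suc (num_tapes M)) (map read (snd c)) = map (word_tape w) hs"
    using ts by (auto simp: c_def nth_append read_def comp_def)
  show "step (other_tm M k) c = (Scan Acc, snd c)" if "tick ds (map (word_tape w) hs) = None"
  proof -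
    have "other_delta M k (Sim q d ds) (map read (snd c)) =
        (Scan Acc, map (\<lambda>s. (s, N)) (map read (snd c)))"
      using q that unfolding other_delta.simps * by simp
    then have "step (other_tm M k) (Sim q d ds, snd c) =
        (Scan Acc, map2 act (map (\<lambda>s. (s, N)) (map read (snd c))) (snd c))"
      by (intro step_delta) auto
    then show ?thesis unfolding map2_act_stay by (simp add: c_def)
  qed
  show "step (other_tm M k) c = (Sim q' (if word_tape w h =
      Blank then d else opposite (snd (as ! 1))) ds',
      map2 act as ts @ (word_tape w, shift (snd (as ! 1)) h) # map (\<lambda>h. (word_tape w, h)) (map2 shift
          ms hs))"
    if t: "tick ds (map (word_tape w) hs) = Some (ds', ms)" and d: "delta M q (map read ts) =
        (q', as)"
      and as: "length as = num_tapes M" for ds' ms q' as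
  proof -
    have "other_delta M k (Sim q d ds) (map read (snd c)) =
        (Sim q' (if word_tape w h = Blank then d else opposite (snd (as ! 1))) ds',
         as @ (word_tape w h, snd (as ! 1)) # zip (map (word_tape w) hs) ms)"
      using q t d unfolding other_delta.simps * by simp
    then have "step (other_tm M k) (Sim q d ds, snd c) =
        (Sim q' (if word_tape w h = Blank then d else opposite (snd (as ! 1))) ds',
         map2 act (as @ (word_tape w h, snd (as ! 1)) # zip (map (word_tape w) hs) ms) (snd c))"
      by (intro step_delta) auto
    moreover have "length ms = length hs" using tick_length[OF t] by simp
    ultimately show ?thesis using ts as map2_act_zip[of ms hs "word_tape w"] by
        (simp add: c_def act_def)
  qed
qed

lemma sim_config_step:
  assumes M: "wf_tm M" and c: "sim_config M k x w t c" and nh: "\<not> halted M (run M x t)"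
    and w: "w \<noteq> []"
  shows "if Suc t < (length w + 1) ^ k then sim_config M k x w (Suc t) (step (other_tm M k) c)
    else fst (step (other_tm M k) c) = Scan Acc"
proof -
  obtain q ts d ds hs where run: "run M x t = (q, ts)"
    and c_eq: "c = (Sim q d ds, ts @ (word_tape w, snd (ts ! 1)) # map (\<lambda>h. (word_tape w, h)) hs)"
    and d: "snd (ts ! 1) < 0 \<longrightarrow> d = R" "int (length w) \<le> snd (ts ! 1) \<longrightarrow> d = L"
    and hs: "length hs = k" and ok: "clock_ok (length w) ds hs"
    and val: "Suc (clock_value (length w) ds hs) + t = (length w + 1) ^ k"
    using c unfolding sim_config_def by blast
  have wfc: "wf_config M (q, ts)" using wf_config_run[OF M, of x t] run by simp
  then have len: "length ts = num_tapes M" by (simp add: wf_config_def)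
  have q: "q \<noteq> accept M" "q \<noteq> reject M" using nh run by (auto simp: halted_def)
  obtain q' as where dM: "delta M q (map read ts) = (q', as)" by fastforce
  have nh': "\<not> halted M (q, ts)" using nh run by simp
  note as = wf_delta_config(2)[OF M wfc nh' dM]
  have m: "1 < num_tapes M" using M by (simp add: wf_tm_def)
  note simps = sim_step_delta[OF q len hs c_eq]
  show ?thesis
  proof (cases "clock_value (length w) ds hs = 0")
    case True
    with val simps(1)[OF tick_None[OF ok True]] show ?thesis by auto
  next
    case False
    then obtain ds' ms where t: "tick ds (map (word_tape w) hs) = Some (ds', ms)"
      and ok': "clock_ok (length w) ds' (map2 shift ms hs)"
      and val': "Suc (clock_value (length w) ds' (map2 shift ms hs)) = clock_value (length w) ds hs"
      using tick_Some[OF ok] by auto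
    have run': "run M x (Suc t) = (q', map2 act as ts)"
      using run step_delta[OF nh' dM] by (simp add: run_Suc)
    have h: "snd (map2 act as ts ! 1) = shift (snd (as ! 1)) (snd (ts ! 1))"
      using as len m by (cases "as ! 1"; cases "ts ! 1") (simp add: act_def)
    define d' where "d' = (if word_tape w (snd (ts ! 1)) = Blank then d else opposite (snd (as ! 1)))"
    have "length ms = length hs" using tick_length[OF t] by simp
    \<comment> \<open>As \<open>w\<close> is nonempty, one move cannot lead from one side of the
      word to the other. So a head off the word keeps its direction, and a head leaving the word
      needs the opposite of its move.\<close>
    moreover have "snd (map2 act as ts ! 1) < 0 \<longrightarrow> d' = R"
      unfolding d'_def h word_tape_Blank using d w by (cases "snd (as ! 1)"; cases w) auto
    moreover have "int (length w) \<le> snd (map2 act as ts ! 1) \<longrightarrow> d' = L"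
      unfolding d'_def h word_tape_Blank using d w by (cases "snd (as ! 1)"; cases w) auto
    ultimately have "sim_config M k x w (Suc t) (step (other_tm M k) c)"
      unfolding sim_config_def simps(2)[OF t dM as] run' h[symmetric] d'_def[symmetric]
      using hs ok' val val'
      by (intro exI[of _ q'] exI[of _ "map2 act as ts"] exI[of _ d'] exI[of _ ds']
          exI[of _ "map2 shift ms hs"]) simp
    with val False show ?thesis by auto
  qed
qed


lemma sim_config_funpow:
  assumes "wf_tm M" "w \<noteq> []" "sim_config M k x w 0 c"
    and "\<And>s. s < t \<Longrightarrow> \<not> halted M (run M x s)" "t < (length w + 1) ^ k"
  shows "sim_config M k x w t ((step (other_tm M k) ^^ t) c)"
  using assms(4,5)
proof (induction t)
  case 0
  show ?case using assms(3) by simp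
next
  case (Suc t)
  then have "sim_config M k x w t ((step (other_tm M k) ^^ t) c)" by simp
  from sim_config_step[OF assms(1) this _ assms(2)] Suc.prems show ?case by (simp split: if_splits)
qed


subsection \<open>The decision\<close>

lemma map2_list_update:
  "length xs = length ys \<Longrightarrow> map2 f (xs[i := a]) ys = (map2 f xs ys)[i := f a (ys ! i)]"
  by (metis (no_types, lifting) case_prod_conv list_update_id map_update zip_update)

text \<open>\<open>F\<close> embeds the abstract search into configurations. In \<open>Acc\<close>
  and \<open>Rej\<close> both sides stand still, the machine because it has halted.\<close>

lemma step_scan:
  assumes ts: "length ts = num_tapes M + Suc k" and m: "2 \<le> num_tapes M"
    and F_def: "F = (\<lambda>(s, i, j). (Scan s, ts[1 := (word_tape v, i), num_tapes M :=
        (word_tape w, j)]))"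
  shows "step (other_tm M k) (F c) = F (scan_step v w c)"
proof -
  obtain s i j where c: "c = (s, i, j)" by (cases c)
  show ?thesis
  proof (cases "s = Acc \<or> s = Rej")
    case True
    then show ?thesis by (auto simp: c F_def step_def halted_def scan_step)
  next
    case False
    define us where "us = ts[1 := (word_tape v, i), num_tapes M := (word_tape w, j)]"
    obtain s' m' n' where s': "scan_move s (word_tape v i) (word_tape w j) = (s', m', n')"
      by (metis surj_pair)
    have us: "us ! 1 = (word_tape v, i)" "us ! num_tapes M = (word_tape w, j)" "length us = length ts"
      using ts m by (simp_all add: us_def)
    have nth: "map read us ! 1 = word_tape v i" "map read us ! num_tapes M = word_tape w j"
      using us ts m by (simp_all add: read_def)
    have "other_delta M k (Scan s) (map read us) =
        (Scan s', (map (\<lambda>s. (s, N)) (map read us))[1 := (word_tape v i, m'), num_tapes M :=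
          (word_tape w j, n')])"
      unfolding other_delta.simps nth s' by simp
    then have "step (other_tm M k) (Scan s, us) = (Scan s',
        map2 act ((map (\<lambda>s. (s, N)) (map read us))[1 := (word_tape v i, m'), num_tapes M :=
            (word_tape w j, n')]) us)"
      using False by (intro step_delta) (auto simp: halted_def)
    also have "\<dots> = (Scan s', us[1 := (word_tape v, shift m' i), num_tapes M :=
        (word_tape w, shift n' j)])"
      by (simp only: map2_list_update length_list_update length_map map2_act_stay us(1,2))
        (simp add: act_def)
    \<comment> \<open>At least two tapes of \<open>M\<close> make the positions 1 and
      \<open>num_tapes M\<close> distinct, so the updates commute.\<close>
    also have "us[1 := (word_tape v, shift m' i), num_tapes M := (word_tape w, shift n' j)] =
        ts[1 := (word_tape v, shift m' i), num_tapes M := (word_tape w, shift n' j)]"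
      using m by (simp add: us_def list_update_swap)
    finally show ?thesis by (simp add: c F_def us_def scan_step s')
  qed
qed

lemma reach_step_scan:
  fixes M :: "'q tm"
  assumes "length ts = num_tapes M + Suc k" "2 \<le> num_tapes M"
    and "reach (scan_step v w) n (s, i, j) (s', i', j')"
  shows "reach (step (other_tm M k)) n
    (Scan s, ts[1 := (word_tape v, i), num_tapes M := (word_tape w, j)])
    (Scan s', ts[1 := (word_tape v, i'), num_tapes M := (word_tape w, j')])"
proof -
  define F :: "scan \<times> int \<times> int \<Rightarrow> 'q st config" where "F = (\<lambda>(s, i, j). (Scan s, ts[1 :=
      (word_tape v, i), num_tapes M := (word_tape w, j)]))"
  have "(step (other_tm M k) ^^ m) (F c) = F ((scan_step v w ^^ m) c)" for m c
    using step_scan[OF assms(1,2) F_def] by (induction m) simp_all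
  then have "reach (step (other_tm M k)) n (F (s, i, j)) (F (s', i', j'))"
    using assms(3) unfolding reach_def by metis
  then show ?thesis by (simp add: F_def)
qed

text \<open>With \<open>B = (l + 1) ^ k\<close>, preparation and positioning cost about
  \<open>4 * l\<close>, the simulation and the way back of the output head at most \<open>B\<close>
  each, and the last summand is the search in an output of length at most \<open>B\<close>.\<close>

definition other_time :: "nat \<Rightarrow> nat \<Rightarrow> nat" where
  "other_time k l = 4 * l + 9 + 2 * (l + 1) ^ k + (l + 1) ^ k * (2 * ((l + 1) ^ k + l + 1) * (l + 1))"

lemma other_time_mono: "l \<le> l' \<Longrightarrow> other_time k l \<le> other_time k l'"
  unfolding other_time_def by (intro add_mono mult_mono power_mono) auto

lemma other_tm_timeout:
  assumes M: "wf_tm M" and x: "x = u @ [EndSet]" "EndSet \<notin> set u"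
    and nh: "\<And>s. s < (length (x @ z) + 1) ^ k \<Longrightarrow> \<not> halted M (run M x s)"
  shows "\<exists>ts. reach (step (other_tm M k)) (other_time k (length (x @ z)))
    (init (other_tm M k) (x @ z)) (Scan Acc, ts)"
proof -
  let ?w = "x @ z" and ?O = "other_tm M k"
  let ?B = "(length ?w + 1) ^ k"
  define c where "c = (Sim (start M) N (replicate k True), snd (init M x) @
      replicate (Suc k) (word_tape ?w, 0))"
  have w: "?w \<noteq> []" using x by simp
  have 1: "reach (step ?O) (2 * length ?w + 2) (init ?O ?w) c"
    unfolding c_def using x M by (intro reach_prelim[of x u]) (simp_all add: wf_tm_def)
  \<comment> \<open>The clock starts at \<open>b\<close>, so \<open>b\<close> steps are simulated
    and the next one finds it empty.\<close>
  obtain b where B: "?B = Suc b" by (cases ?B) auto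
  have sim: "sim_config M k x ?w b ((step ?O ^^ b) c)"
    using nh B by (intro sim_config_funpow[OF M w])
        (auto simp: c_def sim_config_start[OF M w] simp del: replicate_Suc)
  have "\<not> halted M (run M x b)" using nh B by simp
  from sim_config_step[OF M sim this w] have "fst ((step ?O ^^ ?B) c) = Scan Acc"
    unfolding B by simp
  then obtain ts where "(step ?O ^^ ?B) c = (Scan Acc, ts)" by (metis prod.collapse)
  then have 2: "reach (step ?O) ?B c (Scan Acc, ts)" unfolding reach_def by blast
  have "2 * length ?w + 2 + ?B \<le> other_time k (length ?w)"
    unfolding other_time_def by linarith
  from reach_mono[OF reach_trans[OF 1 2] this] show ?thesis by blast
qed

lemma other_tm_decision:
  assumes M: "wf_tm M" and x: "x = u @ [EndSet]" "EndSet \<notin> set u" and z: "z = lines zs @ [EndSet]"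
    and zs: "\<And>b. b \<in> set zs \<Longrightarrow> EndStr \<notin> set b \<and> EndSet \<notin> set b"
    and out: "outputs_within M x (lines ys @ [EndSet]) n" "n < (length (x @ z) + 1) ^ k"
    and ys: "\<And>b. b \<in> set ys \<Longrightarrow> EndStr \<notin> set b \<and> EndSet \<notin> set b"
  shows "\<exists>ts. reach (step (other_tm M k)) (other_time k (length (x @ z)))
      (init (other_tm M k) (x @ z))
    (Scan (if set ys \<subseteq> set zs then Rej else Acc), ts)"
proof -
  let ?w = "x @ z" and ?O = "other_tm M k" and ?v = "lines ys @ [EndSet]"
  let ?B = "(length ?w + 1) ^ k"
  obtain s where s: "s \<le> n" "halted M (run M x s)" "fst (snd (run M x s) ! 1) = word_tape ?v"
    using out(1) by (auto simp: outputs_within_def)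
  \<comment> \<open>The simulation is only followed up to the first halting time; afterwards the
    configuration of \<open>M\<close>, and so its output, no longer changes.\<close>
  define t where "t = (LEAST t. halted M (run M x t))"
  have t: "halted M (run M x t)" unfolding t_def using s(2) by (rule LeastI)
  have "t \<le> s" unfolding t_def using s(2) by (rule Least_le)
  then have run_t: "run M x t = run M x s" by (rule run_halted_mono[OF t, symmetric])
  have tB: "t < ?B" using \<open>t \<le> s\<close> s(1) out(2) by simp
  define c where "c = (Sim (start M) N (replicate k True), snd (init M x) @
      replicate (Suc k) (word_tape ?w, 0))"
  have w: "?w \<noteq> []" using x by simp
  have m: "2 \<le> num_tapes M" using M by (simp add: wf_tm_def)
  have 1: "reach (step ?O) (2 * length ?w + 2) (init ?O ?w) c"
    unfolding c_def using x m by (intro reach_prelim[of x u]) simp_all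
  have "sim_config M k x ?w t ((step ?O ^^ t) c)"
    using tB by (intro sim_config_funpow[OF M w])
      (auto simp: c_def sim_config_start[OF M w] t_def dest: not_less_Least simp del: replicate_Suc)
  then obtain q ts d ds hs where run: "run M x t = (q, ts)"
    and c_t: "(step ?O ^^ t) c = (Sim q d ds,
        ts @ (word_tape ?w, snd (ts ! 1)) # map (\<lambda>h. (word_tape ?w, h)) hs)"
    and d: "snd (ts ! 1) < 0 \<longrightarrow> d = R" "int (length ?w) \<le> snd (ts ! 1) \<longrightarrow> d = L"
    and hs: "length hs = k"
    unfolding sim_config_def by blast
  define h where "h = snd (ts ! 1)"
  define us where "us = ts @ (word_tape ?w, h) # map (\<lambda>h. (word_tape ?w, h)) hs"
  have ts: "length ts = num_tapes M" using wf_config_run[OF M, of x t] run by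
      (simp add: wf_config_def)
  have ts1: "ts ! 1 = (word_tape ?v, h)" using s(3) run run_t by (simp add: h_def prod_eq_iff)
  have us: "us[1 := (word_tape ?v, h), num_tapes M := (word_tape ?w, h)] = us"
  proof -
    have "us ! 1 = (word_tape ?v, h)" "us ! num_tapes M = (word_tape ?w, h)"
      using ts ts1 m by (simp_all add: us_def nth_append)
    then show ?thesis by (metis list_update_id)
  qed
  have "q = accept M \<or> q = reject M" using t run by (simp add: halted_def)
  then have "other_delta M k (Sim q d ds) (map read us) =
      (Scan (Seek d), map (\<lambda>s. (s, N)) (map read us))"
    by auto
  then have "step ?O (Sim q d ds, us) = (Scan (Seek d), map2 act (map (\<lambda>s. (s, N)) (map read us)) us)"
    by (intro step_delta) auto
  then have "(step ?O ^^ Suc t) c = (Scan (Seek d), us)"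
    unfolding map2_act_stay by (simp add: c_t us_def h_def)
  then have 2: "reach (step ?O) (Suc t) c (Scan (Seek d), us)" unfolding reach_def by blast
  \<comment> \<open>The last cell of the output is not blank and was written within \<open>t\<close>
    steps, which bounds the length of the output by \<open>t\<close>.\<close>
  have "word_tape ?v (int (length (lines ys))) = In EndSet" by (rule word_tape_append)
  then have v: "length ?v \<le> t" and h: "nat \<bar>h\<bar> \<le> t"
    using output_tape_bound[OF M, of x t] ts1 run by
        (auto dest!: spec[of _ "int (length (lines ys))"])
  obtain i j where "reach (scan_step ?v ?w)
      (nat \<bar>h\<bar> + 2 * length ?w + 6 + length ?v * (2 * (length ?v + length ?w + 1) * (length ?w + 1)))
      (Seek d, h, h) (if set ys \<subseteq> set zs then Rej else Acc, i, j)"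
    using reach_scan_decision[OF refl, of ?w u zs ys h d] x z ys zs d unfolding h_def by auto
  from reach_step_scan[OF _ m this, of us k, unfolded us]
  have 3: "reach (step ?O)
      (nat \<bar>h\<bar> + 2 * length ?w + 6 + length ?v * (2 * (length ?v + length ?w + 1) * (length ?w + 1)))
      (Scan (Seek d), us) (Scan (if set ys \<subseteq> set zs then Rej else Acc),
        us[1 := (word_tape ?v, i), num_tapes M := (word_tape ?w, j)])"
    using ts hs by (simp add: us_def)
  have "length ?v * (2 * (length ?v + length ?w + 1) * (length ?w + 1)) \<le>
      ?B * (2 * (?B + length ?w + 1) * (length ?w + 1))"
    using v tB by (intro mult_mono add_mono) auto
  then have "2 * length ?w + 2 + Suc t +
      (nat \<bar>h\<bar> + 2 * length ?w + 6 + length ?v * (2 * (length ?v + length ?w + 1) * (length ?w + 1)))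
      \<le> other_time k (length ?w)"
    unfolding other_time_def using h tB by linarith
  from reach_mono[OF reach_trans[OF reach_trans[OF 1 2] 3] this] show ?thesis by blast
qed


section \<open>Renaming states\<close>

text \<open>\<open>from_nat\<close> inverts \<open>to_nat\<close> on the renamed states, so runs
  correspond step by step.\<close>

definition nat_tm :: "'q :: countable tm \<Rightarrow> nat tm" where
  "nat_tm M = \<lparr>num_tapes = num_tapes M, states = to_nat ` states M, tape_alphabet = tape_alphabet M,
     start = to_nat (start M), accept = to_nat (accept M), reject = to_nat (reject M),
     delta = (\<lambda>q ss. map_prod to_nat id (delta M (from_nat q) ss))\<rparr>"

lemma wf_nat_tm:
  assumes "wf_tm M"
  shows "wf_tm (nat_tm M)"
proof -
  have "case delta (nat_tm M) q ss of (q', as) \<Rightarrow>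
      q' \<in> states (nat_tm M) \<and> length as = num_tapes M \<and> fst ` set as \<subseteq> tape_alphabet M"
    if q: "q \<in> states (nat_tm M)" "q \<noteq> accept (nat_tm M)" "q \<noteq> reject (nat_tm M)"
      and ss: "length ss = num_tapes M" "set ss \<subseteq> tape_alphabet M" for q ss
  proof -
    obtain p where p: "q = to_nat p" "p \<in> states M" "p \<noteq> accept M" "p \<noteq> reject M"
      using q by (auto simp: nat_tm_def)
    obtain p' as where d: "delta M p ss = (p', as)" by fastforce
    from wf_delta[OF assms p(2-4) ss d] d p(1) show ?thesis by (auto simp: nat_tm_def)
  qed
  with assms show ?thesis by (auto simp: wf_tm_def nat_tm_def)
qed

lemma run_nat_tm: "run (nat_tm M) w t = map_prod to_nat id (run M w t)"
proof -
  have "step (nat_tm M) (map_prod to_nat id c) = map_prod to_nat id (step M c)" for c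
    by (cases c) (auto simp: step_def halted_def nat_tm_def split: prod.splits)
  then show ?thesis
    by (induction t) (simp_all add: run_def init_def nat_tm_def[of M])
qed

lemma accepts_within_nat_tm: "accepts_within (nat_tm M) w n \<longleftrightarrow> accepts_within M w n"
  by (simp add: accepts_within_def run_nat_tm) (simp add: nat_tm_def)

lemma rejects_within_nat_tm: "rejects_within (nat_tm M) w n \<longleftrightarrow> rejects_within M w n"
  by (simp add: rejects_within_def run_nat_tm) (simp add: nat_tm_def)

lemma poly_time_nat_tm: "poly_time_Another_MCS \<sigma> M \<Longrightarrow> poly_time_Another_MCS \<sigma> (nat_tm M)"
  unfolding poly_time_Another_MCS_def accepts_within_nat_tm rejects_within_nat_tm
  using wf_nat_tm by blast


section \<open>Time in terms of the total length, and the theorem\<close>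

lemma reach_accepts: "reach (step M) m (init M w) (accept M, ts) \<Longrightarrow> m \<le> n \<Longrightarrow> accepts_within M w n"
  unfolding reach_def accepts_within_def run_def by (metis fst_conv le_trans)

lemma reach_rejects: "reach (step M) m (init M w) (reject M, ts) \<Longrightarrow> m \<le> n \<Longrightarrow> rejects_within M w n"
  unfolding reach_def rejects_within_def run_def by (metis fst_conv le_trans)

lemma length_input_le:
  assumes "distinct Xs" "over_alphabet \<sigma> (set Xs)" "distinct Zs" "set Zs \<subseteq> MCS (set Xs)"
    and "\<And>n. \<sigma> n \<le> poly s n"
  defines "n \<equiv> total_length (set Xs) + total_length (set Zs)"
  shows "length (enc_strs Xs @ enc_strs Zs) \<le> n * Suc (poly s n) + 4"
proof -
  have X: "c < poly s n" if "X \<in> set Xs" "c \<in> set X" for X c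
  proof -
    have "c < \<sigma> (total_length (set Xs))" using assms(2) that by (auto simp: over_alphabet_def)
    also have "\<dots> \<le> poly s (total_length (set Xs))" by fact
    also have "\<dots> \<le> poly s n" by (rule poly_nat_mono) (simp add: n_def)
    finally show ?thesis .
  qed
  have Z: "c < poly s n" if "Z \<in> set Zs" "c \<in> set Z" for Z c
    using X MCS_chars[of Z "set Xs" c] that assms(4) by blast
  have "length (enc_strs Xs) \<le> total_length (set Xs) * Suc (poly s n) + 2"
    using X by (intro length_enc_strs_le assms)
  moreover have "length (enc_strs Zs) \<le> total_length (set Zs) * Suc (poly s n) + 2"
    using Z by (intro length_enc_strs_le assms)
  moreover have "n * Suc (poly s n) = total_length (set Xs) * Suc (poly s n)
      + total_length (set Zs) * Suc (poly s n)"
    by (simp only: n_def add_mult_distrib)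
  ultimately show ?thesis by simp
qed

theorem theorem5:
  fixes \<sigma> :: "nat \<Rightarrow> nat"
  assumes "poly_bounded \<sigma>"
    and "\<exists>M :: nat tm. output_poly_MCS_enumeration \<sigma> M"
  shows "\<exists>M :: nat tm. poly_time_Another_MCS \<sigma> M"
proof -
  obtain M :: "nat tm" and p where M: "wf_tm M"
    and enum: "\<And>Xs. distinct Xs \<Longrightarrow> over_alphabet \<sigma> (set Xs) \<Longrightarrow>
      \<exists>Ys. set Ys = MCS (set Xs) \<and> outputs_within M (enc_strs Xs) (enc_strs Ys)
        (poly p (total_length (set Xs) + total_length (MCS (set Xs))))"
    using assms(2) unfolding output_poly_MCS_enumeration_def by blast
  obtain s where s: "\<sigma> n \<le> poly s n" for n using assms(1) by (auto simp: poly_bounded_def)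
  obtain j where j: "poly p n \<le> (n + 2) ^ j" for n using poly_le_power by blast
  \<comment> \<open>The additional digit makes the inequality between \<open>(n + 2) ^ j\<close> and
    the clock strict, even for \<open>j = 0\<close>.\<close>
  define k where "k = Suc j"
  have "poly_bounded (\<lambda>n. other_time k (n * Suc (poly s n) + 4))"
    unfolding other_time_def Suc_eq_plus1 by (intro poly_bounded_intros poly_bounded_poly)
  then obtain r where r: "other_time k (n * Suc (poly s n) + 4) \<le> poly r n" for n
    by (auto simp: poly_bounded_def)
  have "if \<exists>Y \<in> MCS (set Xs). Y \<notin> set Zs
      then accepts_within (other_tm M k) (enc_strs Xs @ enc_strs Zs)
        (poly r (total_length (set Xs) + total_length (set Zs)))
      else rejects_within (other_tm M k) (enc_strs Xs @ enc_strs Zs)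
        (poly r (total_length (set Xs) + total_length (set Zs)))"
    if Xs: "distinct Xs" "over_alphabet \<sigma> (set Xs)" and Zs: "distinct Zs" "set Zs \<subseteq> MCS (set Xs)"
        for Xs Zs
  proof -
    define n where "n = total_length (set Xs) + total_length (set Zs)"
    define w where "w = enc_strs Xs @ enc_strs Zs"
    let ?O = "other_tm M k" and ?B = "(length w + 1) ^ k"
    have "other_time k (length w) \<le> other_time k (n * Suc (poly s n) + 4)"
      unfolding w_def n_def using Xs Zs s by (intro other_time_mono length_input_le)
    with r have time: "other_time k (length w) \<le> poly r n" using le_trans by blast
    \<comment> \<open>Each of the two encodings is strictly longer than its total length because of
      \<open>EndSet\<close>.\<close>
    have "n + 2 \<le> length w"
      using length_enc_strs_ge[OF Xs(1)] length_enc_strs_ge[OF Zs(1)] by (simp add: n_def w_def)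
    then have "(n + 2) ^ j < ?B"
      unfolding k_def by (intro le_less_trans[OF power_mono power_strict_increasing]) auto
    with j have B: "poly p n < ?B" using le_less_trans by blast
    obtain Ys t where Ys: "set Ys = MCS (set Xs)"
      and t: "t = poly p (total_length (set Xs) + total_length (MCS (set Xs)))"
      and out: "outputs_within M (enc_strs Xs) (enc_strs Ys) t"
      using enum[OF Xs] by blast
    have inner: "EndStr \<notin> set b \<and> EndSet \<notin> set b" if "b \<in> set (map enc_chars As)" for b As
      using that enc_chars_inner by auto
    have x: "EndSet \<notin> set (lines (map enc_chars Xs))" by (auto simp: enc_char_def)
    have sub: "set (map enc_chars Ys) \<subseteq> set (map enc_chars Zs) \<longleftrightarrow> set Ys \<subseteq> set Zs"
      using inj_enc_chars by (simp add: inj_image_subset_iff)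
    have decide: "if set Ys \<subseteq> set Zs then rejects_within ?O w (poly r n) else accepts_within ?O w
        (poly r n)"
      if out': "outputs_within M (enc_strs Xs) (enc_strs Ys) t'" and t': "t' < ?B" for t'
    proof -
      obtain ts where "reach (step ?O) (other_time k (length w)) (init ?O w)
          (Scan (if set Ys \<subseteq> set Zs then Rej else Acc), ts)"
        using other_tm_decision[OF M enc_strs_lines x enc_strs_lines inner[of _ Zs]
            out'[unfolded enc_strs_lines[of Ys]] t'[unfolded w_def] inner[of _ Ys],
            folded w_def, unfolded sub] by blast
      then show ?thesis
        using reach_rejects[OF _ time, of ?O w ts] reach_accepts[OF _ time, of ?O w ts]
        by (cases "set Ys \<subseteq> set Zs") simp_all
    qed
    have "if set Ys \<subseteq> set Zs then rejects_within ?O w (poly r n) else accepts_within ?O w (poly r n)"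
    proof (cases "\<exists>t' < ?B. halted M (run M (enc_strs Xs) t')")
      case True
      then obtain t' where t': "t' < ?B" "halted M (run M (enc_strs Xs) t')" by blast
      obtain t'' where t'': "halted M (run M (enc_strs Xs) t'')"
        "fst (snd (run M (enc_strs Xs) t'') ! 1) = word_tape (enc_strs Ys)"
        using out by (auto simp: outputs_within_def)
      \<comment> \<open>Halting configurations of one run coincide, so the output at
        \<open>t'\<close> is correct even if the promised bound \<open>t\<close> exceeds the
        clock.\<close>
      have "run M (enc_strs Xs) t' = run M (enc_strs Xs) t''"
        using run_halted_mono t'(2) t''(1) by (metis nat_le_linear)
      with t'' have "outputs_within M (enc_strs Xs) (enc_strs Ys) t'"
        by (auto simp: outputs_within_def)
      with t'(1) show ?thesis by (intro decide)
    next
      case False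
      \<comment> \<open>Otherwise \<open>Zs\<close> consists of all MCSs, the bound \<open>t\<close>
        equals \<open>poly p n\<close>, and \<open>M\<close> halts before the clock runs
        out.\<close>
      have "\<not> set Ys \<subseteq> set Zs"
      proof
        assume "set Ys \<subseteq> set Zs"
        with Ys Zs have "t = poly p n" by (simp add: t n_def)
        with out B False show False by (auto simp: outputs_within_def)
      qed
      moreover have "accepts_within ?O w (poly r n)"
        using other_tm_timeout[OF M enc_strs_lines x, of "enc_strs Zs" k, folded w_def] False
          reach_accepts[OF _ time, of ?O w] by auto
      ultimately show ?thesis by simp
    qed
    with Ys show ?thesis unfolding n_def w_def by (auto split: if_splits)
  qed
  then have "poly_time_Another_MCS \<sigma> (other_tm M k)"
    using wf_other_tm[OF M] unfolding poly_time_Another_MCS_def by blast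
  then show ?thesis using poly_time_nat_tm by blast
qed

end
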